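(* Let $\mathcal{A}$ be a category with coequalizers, let $(L,R,\eta,\epsilon)$ be an adjunction with $R:\mathcal{A}\to\mathcal{B}$, and let $n\in\mathbb{N}$. Consider the functors $\Lambda_n:\mathcal{B}_n\to\mathcal{B}_{[n]}$ and $U_{[n]}:\mathcal{B}_{[n]}\to\mathcal{B}$ attached to $(L,R)$, and let $\mathsf{M}(U_{[n]})$ be the class of morphisms $f$ in $\mathcal{B}_{[n]}$ such that $U_{[n]}f$ is a monomorphism. 1. If there is a morphism $B_{[n]}\to\Lambda_nC_n$ in $\mathsf{M}(U_{[n]})$ for some $C_n\in\mathcal{B}_n$, then $B_{[n]}\in\mathrm{Im}(\Lambda_n)$. 2. If $B_{[n]}\in\mathcal{B}_{[n]}$ is such that the unit component $\eta_{[n]}B_{[n]}:B_{[n]}\to R_{[n]}L_{[n]}B_{[n]}$ is in $\mathsf{M}(U_{[n]})$, then $B_{[n]}\in\mathrm{Im}(\Lambda_n)$. 3. If $(B_{[n]},b_{[n]})\in\mathcal{B}_{[n+1]}$ belongs to $\mathrm{Im}(\Lambda_{n+1})$, then $\eta_{[n]}B_{[n]}$ is in $\mathsf{M}(U_{[n]})$.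
   Context: Whiskering of a natural transformation by functors is written $F\alpha$, $\alpha G$. Coequalizers in $\mathcal{A}$ are fixed once and for all. An object $X$ belongs to $\mathrm{Im}(F)$ if $X=FC$ for some object $C$. Adjoint decomposition of $(L,R,\eta,\epsilon)$. Define recursively categories $\mathcal{B}_{[n]}$, functors $U_{[n]}:\mathcal{B}_{[n]}\to\mathcal{B}$, adjunctions $(L_{[n]},R_{[n]},\eta_{[n]},\epsilon_{[n]})$ with $R_{[n]}:\mathcal{A}\to\mathcal{B}_{[n]}$ and $U_{[n]}R_{[n]}=R$, and natural transformations $\pi_{[n]}:LU_{[n]}\to L_{[n]}$. For $n=0$: $\mathcal{B}_{[0]}=\mathcal{B}$, $U_{[0]}=\mathrm{Id}$, $(L_{[0]},R_{[0]},\eta_{[0]},\epsilon_{[0]})=(L,R,\eta,\epsilon)$, $\pi_{[0]}=\mathrm{Id}_L$. Given stage $n$: - objects of $\mathcal{B}_{[n+1]}$ are pairs $(B_{[n]},b_{[n]})$ with $B_{[n]}\in\mathcal{B}_{[n]}$ and $b_{[n]}:RL_{[n]}B_{[n]}\to U_{[n]}B_{[n]}$ any morphism in $\mathcal{B}$; morphisms $(B_{[n]},b_{[n]})\to(B'_{[n]},b'_{[n]})$ are morphisms $f:B_{[n]}\to B'_{[n]}$ in $\mathcal{B}_{[n]}$ with $U_{[n]}f\circ b_{[n]}=b'_{[n]}\circ RL_{[n]}f$; $U_{[n,n+1]}:\mathcal{B}_{[n+1]}\to\mathcal{B}_{[n]}$ is the forgetful functor and $U_{[n+1]}=U_{[n]}U_{[n,n+1]}$;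 - $R_{[n+1]}A=(R_{[n]}A,R\epsilon_{[n]}A)$, $R_{[n+1]}f=R_{[n]}f$; - $\pi_{[n,n+1]}B_{[n+1]}:L_{[n]}B_{[n]}\to L_{[n+1]}B_{[n+1]}$ is the coequalizer of $\pi_{[n]}B_{[n]}\circ Lb_{[n]}$ and $\epsilon L_{[n]}B_{[n]}$, both from $LRL_{[n]}B_{[n]}$ to $L_{[n]}B_{[n]}$, where $B_{[n+1]}=(B_{[n]},b_{[n]})$; $\pi_{[n+1]}=\pi_{[n,n+1]}\circ\pi_{[n]}U_{[n,n+1]}$; - the unit and counit of $(L_{[n+1]},R_{[n+1]})$ are determined by $U_{[n,n+1]}\eta_{[n+1]}=R_{[n]}\pi_{[n,n+1]}\circ\eta_{[n]}U_{[n,n+1]}$ and $\epsilon_{[n+1]}\circ\pi_{[n,n+1]}R_{[n+1]}=\epsilon_{[n]}$. Monadic tower of $(L,R)$. $\mathcal{B}_0=\mathcal{B}$, $(L_0,R_0,\eta_0,\epsilon_0)=(L,R,\eta,\epsilon)$. Given $(L_n,R_n,\eta_n,\epsilon_n)$ with $R_n:\mathcal{A}\to\mathcal{B}_n$: $\mathcal{B}_{n+1}$ is the Eilenberg-Moore category of the monad $(R_nL_n,R_n\epsilon_nL_n,\eta_n)$ on $\mathcal{B}_n$, $U_{n,n+1}:\mathcal{B}_{n+1}\to\mathcal{B}_n$ is the forgetful functor, $R_{n+1}:\mathcal{A}\to\mathcal{B}_{n+1}$, $A\mapsto(R_nA,R_n\epsilon_nA)$, is the comparison functor, and $L_{n+1}$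 is its left adjoint, with $L_{n+1}(B_n,\mu_n)$ the coequalizer of $L_n\mu_n,\epsilon_nL_nB_n:L_nR_nL_nB_n\to L_nB_n$; unit and counit $\eta_{n+1},\epsilon_{n+1}$. $U_n:\mathcal{B}_n\to\mathcal{B}$ is the composite of forgetful functors. The functors $\Lambda_n:\mathcal{B}_n\to\mathcal{B}_{[n]}$ are defined recursively, together with natural isomorphisms $\lambda_n:=\epsilon_{[n]}L_n\circ L_{[n]}\Lambda_n\eta_n:L_{[n]}\Lambda_n\to L_n$ (one has $\Lambda_nR_n=R_{[n]}$): $\Lambda_0=\mathrm{Id}$, and $\Lambda_{n+1}(V_n,\mu_n)=(\Lambda_nV_n,\;U_n\mu_n\circ R\lambda_nV_n)$, $U_{[n,n+1]}\Lambda_{n+1}f=\Lambda_nU_{n,n+1}f$. Each $\Lambda_n$ is fully faithful and injective on objects. *)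

theory Defs
  imports Main
begin

section \<open>Categories, functors, adjunctions\<close>

text \<open>
  Categories are given by hom-families. Hom-sets for different pairs of objects need not be
  disjoint, so that a morphism of a category of structured objects can literally be a morphism of
  the underlying category. A category in which every morphism has a unique domain and codomain is
  a special case.
\<close>

record ('o, 'm) cat =
  Ob :: "'o set"
  Hom :: "'o \<Rightarrow> 'o \<Rightarrow> 'm set"
  Id :: "'o \<Rightarrow> 'm"
  Comp :: "'m \<Rightarrow> 'm \<Rightarrow> 'm" (infixl "\<cdot>\<index>" 70)

definition category :: "('o, 'm) cat \<Rightarrow> bool" where
  "category C \<longleftrightarrow>
     (\<forall>X Y. Hom C X Y \<noteq> {} \<longrightarrow> X \<in> Ob C \<and> Y \<in> Ob C) \<and>
     (\<forall>X\<in>Ob C. Id C X \<in> Hom C X X) \<and>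
     (\<forall>X Y Z. \<forall>f\<in>Hom C X Y. \<forall>g\<in>Hom C Y Z. g \<cdot>\<^bsub>C\<^esub> f \<in> Hom C X Z) \<and>
     (\<forall>X Y. \<forall>f\<in>Hom C X Y. f \<cdot>\<^bsub>C\<^esub> Id C X = f \<and> Id C Y \<cdot>\<^bsub>C\<^esub> f = f) \<and>
     (\<forall>W X Y Z. \<forall>f\<in>Hom C W X. \<forall>g\<in>Hom C X Y. \<forall>h\<in>Hom C Y Z.
        h \<cdot>\<^bsub>C\<^esub> (g \<cdot>\<^bsub>C\<^esub> f) = (h \<cdot>\<^bsub>C\<^esub> g) \<cdot>\<^bsub>C\<^esub> f)"

definition monomorphism :: "('o, 'm) cat \<Rightarrow> 'o \<Rightarrow> 'o \<Rightarrow> 'm \<Rightarrow> bool" where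
  "monomorphism C X Y f \<longleftrightarrow> f \<in> Hom C X Y \<and>
     (\<forall>Z. \<forall>g\<in>Hom C Z X. \<forall>h\<in>Hom C Z X. f \<cdot>\<^bsub>C\<^esub> g = f \<cdot>\<^bsub>C\<^esub> h \<longrightarrow> g = h)"

definition coequalizer ::
  "('o, 'm) cat \<Rightarrow> 'o \<Rightarrow> 'o \<Rightarrow> 'm \<Rightarrow> 'm \<Rightarrow> 'o \<Rightarrow> 'm \<Rightarrow> bool" where
  "coequalizer C X Y f g Q q \<longleftrightarrow>
     f \<in> Hom C X Y \<and> g \<in> Hom C X Y \<and> q \<in> Hom C Y Q \<and> q \<cdot>\<^bsub>C\<^esub> f = q \<cdot>\<^bsub>C\<^esub> g \<and>
     (\<forall>Z. \<forall>h\<in>Hom C Y Z. h \<cdot>\<^bsub>C\<^esub> f = h \<cdot>\<^bsub>C\<^esub> g \<longrightarrow> (\<exists>!k. k \<in> Hom C Q Z \<and> k \<cdot>\<^bsub>C\<^esub> q = h))"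

text \<open>A choice function \<open>cq\<close> fixing a coequalizer (object and morphism) of every parallel pair.\<close>

type_synonym ('o, 'm) coeq_choice = "'o \<Rightarrow> 'o \<Rightarrow> 'm \<Rightarrow> 'm \<Rightarrow> 'o \<times> 'm"

definition chosen_coequalizers :: "('o, 'm) cat \<Rightarrow> ('o, 'm) coeq_choice \<Rightarrow> bool" where
  "chosen_coequalizers C cq \<longleftrightarrow>
     (\<forall>X Y. \<forall>f\<in>Hom C X Y. \<forall>g\<in>Hom C X Y.
        coequalizer C X Y f g (fst (cq X Y f g)) (snd (cq X Y f g)))"

record ('oc, 'mc, 'od, 'md) ftor =
  FO :: "'oc \<Rightarrow> 'od"
  FA :: "'oc \<Rightarrow> 'oc \<Rightarrow> 'mc \<Rightarrow> 'md"

definition is_functor ::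
  "('oc, 'mc) cat \<Rightarrow> ('od, 'md) cat \<Rightarrow> ('oc, 'mc, 'od, 'md) ftor \<Rightarrow> bool" where
  "is_functor C D F \<longleftrightarrow>
     (\<forall>X\<in>Ob C. FO F X \<in> Ob D) \<and>
     (\<forall>X Y. \<forall>f\<in>Hom C X Y. FA F X Y f \<in> Hom D (FO F X) (FO F Y)) \<and>
     (\<forall>X\<in>Ob C. FA F X X (Id C X) = Id D (FO F X)) \<and>
     (\<forall>X Y Z. \<forall>f\<in>Hom C X Y. \<forall>g\<in>Hom C Y Z.
        FA F X Z (g \<cdot>\<^bsub>C\<^esub> f) = FA F Y Z g \<cdot>\<^bsub>D\<^esub> FA F X Y f)"

definition id_ftor :: "('o, 'm, 'o, 'm) ftor" where
  "id_ftor = \<lparr>FO = \<lambda>X. X, FA = \<lambda>X Y f. f\<rparr>"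

definition comp_ftor ::
  "('od, 'md, 'oe, 'me) ftor \<Rightarrow> ('oc, 'mc, 'od, 'md) ftor \<Rightarrow> ('oc, 'mc, 'oe, 'me) ftor"
  (infixl "\<circ>\<^sub>F" 75) where
  "G \<circ>\<^sub>F F = \<lparr>FO = \<lambda>X. FO G (FO F X), FA = \<lambda>X Y f. FA G (FO F X) (FO F Y) (FA F X Y f)\<rparr>"

definition nat_trans ::
  "('oc, 'mc) cat \<Rightarrow> ('od, 'md) cat \<Rightarrow> ('oc, 'mc, 'od, 'md) ftor \<Rightarrow> ('oc, 'mc, 'od, 'md) ftor
    \<Rightarrow> ('oc \<Rightarrow> 'md) \<Rightarrow> bool" where
  "nat_trans C D F G \<alpha> \<longleftrightarrow>
     (\<forall>X\<in>Ob C. \<alpha> X \<in> Hom D (FO F X) (FO G X)) \<and>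
     (\<forall>X Y. \<forall>f\<in>Hom C X Y. \<alpha> Y \<cdot>\<^bsub>D\<^esub> FA F X Y f = FA G X Y f \<cdot>\<^bsub>D\<^esub> \<alpha> X)"

definition Im_ftor :: "('oc, 'mc) cat \<Rightarrow> ('oc, 'mc, 'od, 'md) ftor \<Rightarrow> 'od set" where
  "Im_ftor C F = {FO F X | X. X \<in> Ob C}"

text \<open>The morphisms \<open>X \<rightarrow> Y\<close> in the class \<open>M(F)\<close>.\<close>

definition mono_class ::
  "('oc, 'mc) cat \<Rightarrow> ('od, 'md) cat \<Rightarrow> ('oc, 'mc, 'od, 'md) ftor \<Rightarrow> 'oc \<Rightarrow> 'oc \<Rightarrow> 'mc set" where
  "mono_class C D F X Y = {f \<in> Hom C X Y. monomorphism D (FO F X) (FO F Y) (FA F X Y f)}"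

text \<open>The right adjoint goes from \<open>A\<close> to \<open>B\<close>, the left adjoint from \<open>B\<close> to \<open>A\<close>.\<close>

record ('oa, 'ma, 'ob, 'mb) adj =
  catA :: "('oa, 'ma) cat"
  catB :: "('ob, 'mb) cat"
  ladj :: "('ob, 'mb, 'oa, 'ma) ftor"
  radj :: "('oa, 'ma, 'ob, 'mb) ftor"
  unt :: "'ob \<Rightarrow> 'mb"
  counit :: "'oa \<Rightarrow> 'ma"

definition adjunction :: "('oa, 'ma, 'ob, 'mb) adj \<Rightarrow> bool" where
  "adjunction P \<longleftrightarrow>
     category (catA P) \<and> category (catB P) \<and>
     is_functor (catB P) (catA P) (ladj P) \<and> is_functor (catA P) (catB P) (radj P) \<and>
     nat_trans (catB P) (catB P) id_ftor (radj P \<circ>\<^sub>F ladj P) (unt P) \<and>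
     nat_trans (catA P) (catA P) (ladj P \<circ>\<^sub>F radj P) id_ftor (counit P) \<and>
     (\<forall>X\<in>Ob (catB P).
        counit P (FO (ladj P) X) \<cdot>\<^bsub>catA P\<^esub> FA (ladj P) X (FO (radj P) (FO (ladj P) X)) (unt P X)
        = Id (catA P) (FO (ladj P) X)) \<and>
     (\<forall>A\<in>Ob (catA P).
        FA (radj P) (FO (ladj P) (FO (radj P) A)) A (counit P A) \<cdot>\<^bsub>catB P\<^esub> unt P (FO (radj P) A)
        = Id (catB P) (FO (radj P) A))"


section \<open>Objects of the towers\<close>

text \<open>
  The objects at stage \<open>n\<close> of either tower are \<open>n\<close>-fold nested pairs over an object of \<open>B\<close>:
  \<open>Ext X b\<close> is the pair \<open>(X, b)\<close>, and \<open>Base B\<close> is the object \<open>B\<close> itself, viewed at stage \<open>0\<close>.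
  Since the forgetful functors are faithful, the morphisms at each stage are taken to be morphisms
  of \<open>B\<close>, of the same type at all stages.
\<close>

datatype ('ob, 'mb) tob =
    Base (root: 'ob)
  | Ext (lower: "('ob, 'mb) tob") (action: 'mb)

definition drop_ftor :: "(('ob, 'mb) tob, 'mb, ('ob, 'mb) tob, 'mb) ftor" where
  "drop_ftor = \<lparr>FO = lower, FA = \<lambda>X Y f. f\<rparr>"

text \<open>
  The functors to \<open>B\<close> (both \<open>U\<^sub>n\<close> and \<open>U\<^sub>[\<^sub>n\<^sub>]\<close>), composites of one-step forgetful functors; at stage
  \<open>0\<close> the identity up to the tag \<open>Base\<close>.
\<close>

primrec forget :: "nat \<Rightarrow> (('ob, 'mb) tob, 'mb, 'ob, 'mb) ftor" where
  "forget 0 = \<lparr>FO = root, FA = \<lambda>X Y f. f\<rparr>"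
| "forget (Suc n) = forget n \<circ>\<^sub>F drop_ftor"

definition base_cat :: "('ob, 'mb) cat \<Rightarrow> (('ob, 'mb) tob, 'mb) cat" where
  "base_cat B = \<lparr>
     Ob = Base ` Ob B,
     Hom = \<lambda>X Y. {f. X \<in> Base ` Ob B \<and> Y \<in> Base ` Ob B \<and> f \<in> Hom B (root X) (root Y)},
     Id = \<lambda>X. Id B (root X),
     Comp = Comp B\<rparr>"

definition base_adj :: "('oa, 'ma, 'ob, 'mb) adj \<Rightarrow> ('oa, 'ma, ('ob, 'mb) tob, 'mb) adj" where
  "base_adj P = \<lparr>
     catA = catA P,
     catB = base_cat (catB P),
     ladj = ladj P \<circ>\<^sub>F \<lparr>FO = root, FA = \<lambda>X Y f. f\<rparr>,
     radj = \<lparr>FO = Base, FA = \<lambda>X Y f. f\<rparr> \<circ>\<^sub>F radj P,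
     unt = \<lambda>X. unt P (root X),
     counit = counit P\<rparr>"

text \<open>
  From the adjunction \<open>S\<close> at stage \<open>n\<close> to the adjunction at stage \<open>n + 1\<close>, for both towers.
  \<open>C\<close> is the category at stage \<open>n + 1\<close>, \<open>R'\<close> the right adjoint, and \<open>c X\<close> consists of the object
  \<open>L\<^sub>n\<^sub>+\<^sub>1 X\<close> and the coequalizer morphism \<open>\<pi> X : L\<^sub>n (lower X) \<rightarrow> L\<^sub>n\<^sub>+\<^sub>1 X\<close>. The left adjoint on
  morphisms is determined by naturality of \<open>\<pi>\<close>, the unit by \<open>U \<eta>\<^sub>n\<^sub>+\<^sub>1 = R\<^sub>n \<pi> \<circ> \<eta>\<^sub>n U\<close> (the one-step
  forgetful functor \<open>U\<close> being the identity on morphisms) and the counit by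
  \<open>\<epsilon>\<^sub>n\<^sub>+\<^sub>1 \<circ> \<pi> R\<^sub>n\<^sub>+\<^sub>1 = \<epsilon>\<^sub>n\<close>.
\<close>

definition lift_adj ::
  "('oa, 'ma, ('ob, 'mb) tob, 'mb) adj \<Rightarrow> (('ob, 'mb) tob, 'mb) cat
    \<Rightarrow> ('oa, 'ma, ('ob, 'mb) tob, 'mb) ftor \<Rightarrow> (('ob, 'mb) tob \<Rightarrow> 'oa \<times> 'ma)
    \<Rightarrow> ('oa, 'ma, ('ob, 'mb) tob, 'mb) adj" where
  "lift_adj S C R' c = \<lparr>
     catA = catA S,
     catB = C,
     ladj = \<lparr>
       FO = \<lambda>X. fst (c X),
       FA = \<lambda>X Y f. THE k. k \<in> Hom (catA S) (fst (c X)) (fst (c Y)) \<and>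
              k \<cdot>\<^bsub>catA S\<^esub> snd (c X) = snd (c Y) \<cdot>\<^bsub>catA S\<^esub> FA (ladj S) (lower X) (lower Y) f\<rparr>,
     radj = R',
     unt = \<lambda>X. FA (radj S) (FO (ladj S) (lower X)) (fst (c X)) (snd (c X))
              \<cdot>\<^bsub>catB S\<^esub> unt S (lower X),
     counit = \<lambda>A. THE k. k \<in> Hom (catA S) (fst (c (FO R' A))) A \<and>
              k \<cdot>\<^bsub>catA S\<^esub> snd (c (FO R' A)) = counit S A\<rparr>"


section \<open>The adjoint decomposition\<close>

text \<open>
  In this section \<open>P\<close> is the given adjunction, \<open>S\<close> the adjunction at stage \<open>n\<close>, and \<open>p\<close> the natural
  transformation \<open>\<pi>\<^sub>[\<^sub>n\<^sub>]\<close>.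
\<close>

definition dec_Ob ::
  "('oa, 'ma, 'ob, 'mb) adj \<Rightarrow> nat \<Rightarrow> ('oa, 'ma, ('ob, 'mb) tob, 'mb) adj
    \<Rightarrow> ('ob, 'mb) tob set" where
  "dec_Ob P n S = {Ext X b | X b. X \<in> Ob (catB S) \<and>
     b \<in> Hom (catB P) (FO (radj P \<circ>\<^sub>F ladj S) X) (FO (forget n) X)}"

definition dec_cat ::
  "('oa, 'ma, 'ob, 'mb) adj \<Rightarrow> nat \<Rightarrow> ('oa, 'ma, ('ob, 'mb) tob, 'mb) adj
    \<Rightarrow> (('ob, 'mb) tob, 'mb) cat" where
  "dec_cat P n S = \<lparr>
     Ob = dec_Ob P n S,
     Hom = \<lambda>X Y. {f. X \<in> dec_Ob P n S \<and> Y \<in> dec_Ob P n S \<and>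
       f \<in> Hom (catB S) (lower X) (lower Y) \<and>
       FA (forget n) (lower X) (lower Y) f \<cdot>\<^bsub>catB P\<^esub> action X
       = action Y \<cdot>\<^bsub>catB P\<^esub> FA (radj P \<circ>\<^sub>F ladj S) (lower X) (lower Y) f},
     Id = \<lambda>X. Id (catB S) (lower X),
     Comp = Comp (catB S)\<rparr>"

definition dec_R ::
  "('oa, 'ma, 'ob, 'mb) adj \<Rightarrow> ('oa, 'ma, ('ob, 'mb) tob, 'mb) adj
    \<Rightarrow> ('oa, 'ma, ('ob, 'mb) tob, 'mb) ftor" where
  "dec_R P S = \<lparr>
     FO = \<lambda>A. Ext (FO (radj S) A) (FA (radj P) (FO (ladj S \<circ>\<^sub>F radj S) A) A (counit S A)),
     FA = FA (radj S)\<rparr>"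

text \<open>
  The parallel pair is \<open>\<pi>\<^sub>[\<^sub>n\<^sub>] B \<circ> L b, \<epsilon> L\<^sub>[\<^sub>n\<^sub>] B : L R L\<^sub>[\<^sub>n\<^sub>] B \<rightarrow> L\<^sub>[\<^sub>n\<^sub>] B\<close>, with the original \<open>L\<close>, \<open>R\<close>
  and \<open>\<epsilon>\<close>; in the monadic tower below it is formed with the adjunction at stage \<open>n\<close> throughout.
\<close>

definition dec_coeq ::
  "('oa, 'ma, 'ob, 'mb) adj \<Rightarrow> ('oa, 'ma) coeq_choice \<Rightarrow> nat
    \<Rightarrow> ('oa, 'ma, ('ob, 'mb) tob, 'mb) adj \<Rightarrow> (('ob, 'mb) tob \<Rightarrow> 'ma)
    \<Rightarrow> ('ob, 'mb) tob \<Rightarrow> 'oa \<times> 'ma" where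
  "dec_coeq P cq n S p X =
     cq (FO (ladj P \<circ>\<^sub>F radj P \<circ>\<^sub>F ladj S) (lower X)) (FO (ladj S) (lower X))
        (p (lower X) \<cdot>\<^bsub>catA P\<^esub>
          FA (ladj P) (FO (radj P \<circ>\<^sub>F ladj S) (lower X)) (FO (forget n) (lower X)) (action X))
        (counit P (FO (ladj S) (lower X)))"

primrec decomp ::
  "('oa, 'ma, 'ob, 'mb) adj \<Rightarrow> ('oa, 'ma) coeq_choice \<Rightarrow> nat
    \<Rightarrow> ('oa, 'ma, ('ob, 'mb) tob, 'mb) adj \<times> (('ob, 'mb) tob \<Rightarrow> 'ma)" where
  "decomp P cq 0 = (base_adj P, \<lambda>X. Id (catA P) (FO (ladj P) (root X)))"
| "decomp P cq (Suc n) = (let (S, p) = decomp P cq n; c = dec_coeq P cq n S p in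
     (lift_adj S (dec_cat P n S) (dec_R P S) c,
      \<lambda>X. snd (c X) \<cdot>\<^bsub>catA P\<^esub> p (lower X)))"

text \<open>\<open>(L\<^sub>[\<^sub>n\<^sub>], R\<^sub>[\<^sub>n\<^sub>], \<eta>\<^sub>[\<^sub>n\<^sub>], \<epsilon>\<^sub>[\<^sub>n\<^sub>])\<close>, with category \<open>B\<^sub>[\<^sub>n\<^sub>]\<close>.\<close>

definition dec_adj ::
  "('oa, 'ma, 'ob, 'mb) adj \<Rightarrow> ('oa, 'ma) coeq_choice \<Rightarrow> nat
    \<Rightarrow> ('oa, 'ma, ('ob, 'mb) tob, 'mb) adj" where
  "dec_adj P cq n = fst (decomp P cq n)"


section \<open>The monadic tower\<close>

definition EM_Ob ::
  "(('ob, 'mb) tob, 'mb) cat \<Rightarrow> (('ob, 'mb) tob, 'mb, ('ob, 'mb) tob, 'mb) ftor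
    \<Rightarrow> (('ob, 'mb) tob \<Rightarrow> 'mb) \<Rightarrow> (('ob, 'mb) tob \<Rightarrow> 'mb) \<Rightarrow> ('ob, 'mb) tob set" where
  "EM_Ob C T m e = {Ext X a | X a. X \<in> Ob C \<and> a \<in> Hom C (FO T X) X \<and>
     a \<cdot>\<^bsub>C\<^esub> e X = Id C X \<and> a \<cdot>\<^bsub>C\<^esub> FA T (FO T X) X a = a \<cdot>\<^bsub>C\<^esub> m X}"

definition EM_cat ::
  "(('ob, 'mb) tob, 'mb) cat \<Rightarrow> (('ob, 'mb) tob, 'mb, ('ob, 'mb) tob, 'mb) ftor
    \<Rightarrow> (('ob, 'mb) tob \<Rightarrow> 'mb) \<Rightarrow> (('ob, 'mb) tob \<Rightarrow> 'mb) \<Rightarrow> (('ob, 'mb) tob, 'mb) cat" where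
  "EM_cat C T m e = \<lparr>
     Ob = EM_Ob C T m e,
     Hom = \<lambda>X Y. {f. X \<in> EM_Ob C T m e \<and> Y \<in> EM_Ob C T m e \<and>
       f \<in> Hom C (lower X) (lower Y) \<and>
       f \<cdot>\<^bsub>C\<^esub> action X = action Y \<cdot>\<^bsub>C\<^esub> FA T (lower X) (lower Y) f},
     Id = \<lambda>X. Id C (lower X),
     Comp = Comp C\<rparr>"

definition adj_EM ::
  "('oa, 'ma, ('ob, 'mb) tob, 'mb) adj \<Rightarrow> (('ob, 'mb) tob, 'mb) cat" where
  "adj_EM S = EM_cat (catB S) (radj S \<circ>\<^sub>F ladj S)
     (\<lambda>X. FA (radj S) (FO (ladj S \<circ>\<^sub>F radj S \<circ>\<^sub>F ladj S) X) (FO (ladj S) X)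
            (counit S (FO (ladj S) X)))
     (unt S)"

definition comparison ::
  "('oa, 'ma, ('ob, 'mb) tob, 'mb) adj \<Rightarrow> ('oa, 'ma, ('ob, 'mb) tob, 'mb) ftor" where
  "comparison S = \<lparr>
     FO = \<lambda>A. Ext (FO (radj S) A) (FA (radj S) (FO (ladj S \<circ>\<^sub>F radj S) A) A (counit S A)),
     FA = FA (radj S)\<rparr>"

definition mon_coeq ::
  "('oa, 'ma) coeq_choice \<Rightarrow> ('oa, 'ma, ('ob, 'mb) tob, 'mb) adj
    \<Rightarrow> ('ob, 'mb) tob \<Rightarrow> 'oa \<times> 'ma" where
  "mon_coeq cq S X =
     cq (FO (ladj S \<circ>\<^sub>F radj S \<circ>\<^sub>F ladj S) (lower X)) (FO (ladj S) (lower X))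
        (FA (ladj S) (FO (radj S \<circ>\<^sub>F ladj S) (lower X)) (lower X) (action X))
        (counit S (FO (ladj S) (lower X)))"

text \<open>\<open>(L\<^sub>n, R\<^sub>n, \<eta>\<^sub>n, \<epsilon>\<^sub>n)\<close>, with category \<open>B\<^sub>n\<close>.\<close>

primrec mon_adj ::
  "('oa, 'ma, 'ob, 'mb) adj \<Rightarrow> ('oa, 'ma) coeq_choice \<Rightarrow> nat
    \<Rightarrow> ('oa, 'ma, ('ob, 'mb) tob, 'mb) adj" where
  "mon_adj P cq 0 = base_adj P"
| "mon_adj P cq (Suc n) =
     (let S = mon_adj P cq n in lift_adj S (adj_EM S) (comparison S) (mon_coeq cq S))"


section \<open>The comparison between the two towers\<close>

text \<open>
  The components of \<open>\<epsilon>\<^sub>[\<^sub>n\<^sub>] L\<^sub>n \<circ> L\<^sub>[\<^sub>n\<^sub>] \<Lambda>\<^sub>n \<eta>\<^sub>n\<close>, where \<open>M\<close> and \<open>D\<close> are the stage \<open>n\<close> adjunctions of the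
  monadic tower and of the adjoint decomposition, and \<open>\<Lambda>\<close> is \<open>\<Lambda>\<^sub>n\<close>. Here \<open>\<Lambda>\<^sub>n R\<^sub>n = R\<^sub>[\<^sub>n\<^sub>]\<close>.
\<close>

definition lambda_iso ::
  "('oa, 'ma, ('ob, 'mb) tob, 'mb) adj \<Rightarrow> ('oa, 'ma, ('ob, 'mb) tob, 'mb) adj
    \<Rightarrow> (('ob, 'mb) tob, 'mb, ('ob, 'mb) tob, 'mb) ftor \<Rightarrow> ('ob, 'mb) tob \<Rightarrow> 'ma" where
  "lambda_iso M D \<Lambda> V =
     counit D (FO (ladj M) V) \<cdot>\<^bsub>catA D\<^esub>
     FA (ladj D \<circ>\<^sub>F \<Lambda>) V (FO (radj M \<circ>\<^sub>F ladj M) V) (unt M V)"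

primrec Lam ::
  "('oa, 'ma, 'ob, 'mb) adj \<Rightarrow> ('oa, 'ma) coeq_choice \<Rightarrow> nat
    \<Rightarrow> (('ob, 'mb) tob, 'mb, ('ob, 'mb) tob, 'mb) ftor" where
  "Lam P cq 0 = id_ftor"
| "Lam P cq (Suc n) = (let M = mon_adj P cq n; D = dec_adj P cq n; \<Lambda> = Lam P cq n in \<lparr>
     FO = \<lambda>X. Ext (FO \<Lambda> (lower X))
       (FA (forget n) (FO (radj M \<circ>\<^sub>F ladj M) (lower X)) (lower X) (action X) \<cdot>\<^bsub>catB P\<^esub>
        FA (radj P) (FO (ladj D \<circ>\<^sub>F \<Lambda>) (lower X)) (FO (ladj M) (lower X))
          (lambda_iso M D \<Lambda> (lower X))),
     FA = \<lambda>X Y f. FA \<Lambda> (lower X) (lower Y) f\<rparr>)"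

end

theory Submission
  imports Defs
begin

text \<open>
  The arrows of all stages of both towers are arrows of \<open>B\<close>, with the same composition, so a stage
  only decides which arrows of \<open>B\<close> are admitted between two of its objects. In these terms
  \<open>\<Lambda>\<^sub>n\<close> does nothing to arrows, and its being fully faithful is an equality of hom-sets.

  Each stage of either tower is an adjunction by one and the same argument. If \<open>X\<close> is an object
  \<open>V\<close> of the previous stage with an action \<open>b : R L V \<rightarrow> U V\<close>, then an arrow \<open>h : L V \<rightarrow> a\<close>
  coequalizes the parallel pair attached to \<open>b\<close> exactly when its adjunct \<open>V \<rightarrow> R a\<close> respects the
  actions, that is, when it is an arrow \<open>X \<rightarrow> R' a\<close> of the new stage (locale \<open>extension\<close>). Hence the
  coequalizer carries a universal arrow from \<open>X\<close> to \<open>R'\<close> (locale \<open>lifting\<close>).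

  As \<open>\<Lambda>\<^sub>n\<close> is fully faithful and \<open>\<Lambda>\<^sub>n R\<^sub>n = R\<^sub>[\<^sub>n\<^sub>]\<close>, both \<open>L\<^sub>[\<^sub>n\<^sub>] \<Lambda>\<^sub>n\<close> and \<open>L\<^sub>n\<close> are left adjoint to
  \<open>R\<^sub>n\<close>, and \<open>\<lambda>\<^sub>n\<close> is the resulting natural isomorphism, characterised by having adjunct \<open>\<eta>\<^sub>n\<close>.
  The action of \<open>\<Lambda>\<^sub>n\<^sub>+\<^sub>1 (V, \<mu>)\<close> is \<open>\<mu> \<circ> R \<lambda>\<close>; cancelling \<open>R \<lambda>\<close> shows that \<open>\<Lambda>\<^sub>n\<^sub>+\<^sub>1\<close> has the same
  properties, and the induction goes on.

  For the first claim, let \<open>f : (X, b) \<rightarrow> \<Lambda>\<^sub>n\<^sub>+\<^sub>1 (C, c)\<close> be mono in \<open>B\<close>. By induction \<open>X = \<Lambda>\<^sub>n V\<close>.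
  Let \<open>\<mu>\<close> be \<open>b\<close> composed with the inverse of \<open>R \<lambda>\<close>, so that \<open>f \<circ> \<mu> = c \<circ> R L\<^sub>n f\<close>. The right-hand side
  is an arrow of \<open>B\<^sub>n\<close>. Compatibility with an action can be tested after composition with a mono,
  so \<open>\<mu>\<close> is an arrow of \<open>B\<^sub>n\<close> too (lemma \<open>mon_hom_reflect\<close>), and in the same way it inherits
  the laws of an algebra from \<open>c\<close> (lemma \<open>subalgebra\<close>). So \<open>(X, b) = \<Lambda>\<^sub>n\<^sub>+\<^sub>1 (V, \<mu>)\<close>.

  The second claim is the first for \<open>\<eta>\<^sub>[\<^sub>n\<^sub>] : X \<rightarrow> R\<^sub>[\<^sub>n\<^sub>] L\<^sub>[\<^sub>n\<^sub>] X = \<Lambda>\<^sub>n R\<^sub>n L\<^sub>[\<^sub>n\<^sub>] X\<close>. For the third, the unit law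
  of the algebra \<open>(V, \<mu>)\<close> says that the action \<open>\<mu> \<circ> R \<lambda>\<close> is a retraction of the unit at \<open>\<Lambda>\<^sub>n V\<close>.
\<close>

section \<open>Adjuncts\<close>

lemma monomorphism_cancel:
  "\<lbrakk>monomorphism C X Y f; f \<cdot>\<^bsub>C\<^esub> g = f \<cdot>\<^bsub>C\<^esub> h; g \<in> Hom C Z X; h \<in> Hom C Z X\<rbrakk> \<Longrightarrow> g = h"
  unfolding monomorphism_def by blast

context
  fixes C :: "('o, 'm) cat"
  assumes C: "category C"
begin

lemma hom_dom: "f \<in> Hom C X Y \<Longrightarrow> X \<in> Ob C"
  using C unfolding category_def by blast

lemma hom_cod: "f \<in> Hom C X Y \<Longrightarrow> Y \<in> Ob C"
  using C unfolding category_def by blast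

lemma id_hom: "X \<in> Ob C \<Longrightarrow> Id C X \<in> Hom C X X"
  using C unfolding category_def by blast

lemma comp_hom: "\<lbrakk>f \<in> Hom C X Y; g \<in> Hom C Y Z\<rbrakk> \<Longrightarrow> g \<cdot>\<^bsub>C\<^esub> f \<in> Hom C X Z"
  using C unfolding category_def by blast

lemma comp_id: "f \<in> Hom C X Y \<Longrightarrow> f \<cdot>\<^bsub>C\<^esub> Id C X = f"
  using C unfolding category_def by blast

lemma id_comp: "f \<in> Hom C X Y \<Longrightarrow> Id C Y \<cdot>\<^bsub>C\<^esub> f = f"
  using C unfolding category_def by blast

lemma comp_assoc:
  "\<lbrakk>f \<in> Hom C W X; g \<in> Hom C X Y; h \<in> Hom C Y Z\<rbrakk>
    \<Longrightarrow> (h \<cdot>\<^bsub>C\<^esub> g) \<cdot>\<^bsub>C\<^esub> f = h \<cdot>\<^bsub>C\<^esub> (g \<cdot>\<^bsub>C\<^esub> f)"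
  using C unfolding category_def by metis

lemma coequalizer_epi:
  assumes q: "coequalizer C X Y f g Q q" and k: "k \<in> Hom C Q Z" and k': "k' \<in> Hom C Q Z"
    and eq: "k \<cdot>\<^bsub>C\<^esub> q = k' \<cdot>\<^bsub>C\<^esub> q"
  shows "k = k'"
proof -
  have f: "f \<in> Hom C X Y" and g: "g \<in> Hom C X Y" and qh: "q \<in> Hom C Y Q"
    and qfg: "q \<cdot>\<^bsub>C\<^esub> f = q \<cdot>\<^bsub>C\<^esub> g"
    using q by (auto simp: coequalizer_def)
  have "(k \<cdot>\<^bsub>C\<^esub> q) \<cdot>\<^bsub>C\<^esub> f = (k \<cdot>\<^bsub>C\<^esub> q) \<cdot>\<^bsub>C\<^esub> g"
    by (simp add: comp_assoc[OF f qh k] comp_assoc[OF g qh k] qfg)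
  then have "\<exists>!l. l \<in> Hom C Q Z \<and> l \<cdot>\<^bsub>C\<^esub> q = k \<cdot>\<^bsub>C\<^esub> q"
    using q comp_hom[OF qh k] unfolding coequalizer_def by blast
  then show ?thesis using k k' eq by metis
qed

lemma split_monomorphism:
  assumes f: "f \<in> Hom C X Y" and r: "r \<in> Hom C Y X" and rf: "r \<cdot>\<^bsub>C\<^esub> f = Id C X"
  shows "monomorphism C X Y f"
  unfolding monomorphism_def
proof (intro conjI f allI ballI impI)
  fix Z g h
  assume g: "g \<in> Hom C Z X" and h: "h \<in> Hom C Z X" and eq: "f \<cdot>\<^bsub>C\<^esub> g = f \<cdot>\<^bsub>C\<^esub> h"
  have "g = (r \<cdot>\<^bsub>C\<^esub> f) \<cdot>\<^bsub>C\<^esub> g" using g rf by (simp add: id_comp)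
  also have "\<dots> = (r \<cdot>\<^bsub>C\<^esub> f) \<cdot>\<^bsub>C\<^esub> h" using eq comp_assoc[OF g f r] comp_assoc[OF h f r] by simp
  also have "\<dots> = h" using h rf by (simp add: id_comp)
  finally show "g = h" .
qed

end

context
  fixes C :: "('oc, 'mc) cat" and D :: "('od, 'md) cat" and F
  assumes F: "is_functor C D F"
begin

lemma functor_ob: "X \<in> Ob C \<Longrightarrow> FO F X \<in> Ob D"
  using F unfolding is_functor_def by blast

lemma functor_hom: "f \<in> Hom C X Y \<Longrightarrow> FA F X Y f \<in> Hom D (FO F X) (FO F Y)"
  using F unfolding is_functor_def by blast

lemma functor_id: "X \<in> Ob C \<Longrightarrow> FA F X X (Id C X) = Id D (FO F X)"
  using F unfolding is_functor_def by blast

lemma functor_comp: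
  "\<lbrakk>f \<in> Hom C X Y; g \<in> Hom C Y Z\<rbrakk> \<Longrightarrow> FA F X Z (g \<cdot>\<^bsub>C\<^esub> f) = FA F Y Z g \<cdot>\<^bsub>D\<^esub> FA F X Y f"
  using F unfolding is_functor_def by blast

end

locale adjoint =
  fixes S :: "('oa, 'ma, 'ob, 'mb) adj"
  assumes adjunction: "adjunction S"
begin

abbreviation "A \<equiv> catA S"
abbreviation "B \<equiv> catB S"
abbreviation "LO \<equiv> FO (ladj S)"
abbreviation "LA \<equiv> FA (ladj S)"
abbreviation "RO \<equiv> FO (radj S)"
abbreviation "RA \<equiv> FA (radj S)"
abbreviation "\<eta> \<equiv> unt S"
abbreviation "\<epsilon> \<equiv> counit S"

lemma catA: "category A" and catB: "category B"
  and ladj_functor: "is_functor B A (ladj S)" and radj_functor: "is_functor A B (radj S)"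
  using adjunction by (simp_all add: adjunction_def)

lemmas A_dom = hom_dom[OF catA] and A_cod = hom_cod[OF catA] and A_id = id_hom[OF catA]
  and A_comp = comp_hom[OF catA] and A_comp_id = comp_id[OF catA] and A_id_comp = id_comp[OF catA]
  and A_assoc = comp_assoc[OF catA]

lemmas B_dom = hom_dom[OF catB] and B_cod = hom_cod[OF catB] and B_id = id_hom[OF catB]
  and B_comp = comp_hom[OF catB] and B_comp_id = comp_id[OF catB] and B_id_comp = id_comp[OF catB]
  and B_assoc = comp_assoc[OF catB]

lemmas LO_ob = functor_ob[OF ladj_functor] and LA_hom = functor_hom[OF ladj_functor]
  and LA_id = functor_id[OF ladj_functor] and LA_comp = functor_comp[OF ladj_functor]

lemmas RO_ob = functor_ob[OF radj_functor] and RA_hom = functor_hom[OF radj_functor]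
  and RA_id = functor_id[OF radj_functor] and RA_comp = functor_comp[OF radj_functor]

lemma unt_hom: "X \<in> Ob B \<Longrightarrow> \<eta> X \<in> Hom B X (RO (LO X))"
  and unt_nat: "f \<in> Hom B X Y \<Longrightarrow> \<eta> Y \<cdot>\<^bsub>B\<^esub> f = RA (LO X) (LO Y) (LA X Y f) \<cdot>\<^bsub>B\<^esub> \<eta> X"
  and counit_hom: "a \<in> Ob A \<Longrightarrow> \<epsilon> a \<in> Hom A (LO (RO a)) a"
  and counit_nat: "h \<in> Hom A a b \<Longrightarrow>
    \<epsilon> b \<cdot>\<^bsub>A\<^esub> LA (RO a) (RO b) (RA a b h) = h \<cdot>\<^bsub>A\<^esub> \<epsilon> a"
  using adjunction unfolding adjunction_def nat_trans_def id_ftor_def comp_ftor_def by simp_all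

lemma counit_LA_unt: "X \<in> Ob B \<Longrightarrow> \<epsilon> (LO X) \<cdot>\<^bsub>A\<^esub> LA X (RO (LO X)) (\<eta> X) = Id A (LO X)"
  and RA_counit_unt: "a \<in> Ob A \<Longrightarrow> RA (LO (RO a)) a (\<epsilon> a) \<cdot>\<^bsub>B\<^esub> \<eta> (RO a) = Id B (RO a)"
  using adjunction unfolding adjunction_def by simp_all

definition adjunct :: "'ob \<Rightarrow> 'oa \<Rightarrow> 'ma \<Rightarrow> 'mb" where
  "adjunct X a h = RA (LO X) a h \<cdot>\<^bsub>B\<^esub> \<eta> X"

lemma adjunct_hom:
  assumes "X \<in> Ob B" "h \<in> Hom A (LO X) a"
  shows "adjunct X a h \<in> Hom B X (RO a)"
  unfolding adjunct_def using assms by (blast intro: B_comp unt_hom RA_hom)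

lemma counit_LA_adjunct:
  assumes X: "X \<in> Ob B" and h: "h \<in> Hom A (LO X) a"
  shows "\<epsilon> a \<cdot>\<^bsub>A\<^esub> LA X (RO a) (adjunct X a h) = h"
proof -
  note u = unt_hom[OF X] and r = RA_hom[OF h]
  have "\<epsilon> a \<cdot>\<^bsub>A\<^esub> LA X (RO a) (adjunct X a h) =
    (\<epsilon> a \<cdot>\<^bsub>A\<^esub> LA (RO (LO X)) (RO a) (RA (LO X) a h)) \<cdot>\<^bsub>A\<^esub> LA X (RO (LO X)) (\<eta> X)"
    unfolding adjunct_def
    by (simp add: LA_comp[OF u r] A_assoc[OF LA_hom[OF u] LA_hom[OF r] counit_hom[OF A_cod[OF h]]])
  also have "\<dots> = h \<cdot>\<^bsub>A\<^esub> (\<epsilon> (LO X) \<cdot>\<^bsub>A\<^esub> LA X (RO (LO X)) (\<eta> X))"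
    by (simp add: counit_nat[OF h] A_assoc[OF LA_hom[OF u] counit_hom[OF A_dom[OF h]] h])
  also have "\<dots> = h" by (simp add: counit_LA_unt[OF X] A_comp_id[OF h])
  finally show ?thesis .
qed

text \<open>Equations between arrows out of \<open>L X\<close> are proved below by comparing adjuncts.\<close>

lemma adjunct_inject:
  assumes "X \<in> Ob B" "h \<in> Hom A (LO X) a" "k \<in> Hom A (LO X) a"
    and "adjunct X a h = adjunct X a k"
  shows "h = k"
  using assms counit_LA_adjunct by metis

lemma adjunct_comp:
  assumes X: "X \<in> Ob B" and h: "h \<in> Hom A (LO X) a" and k: "k \<in> Hom A a b"
  shows "adjunct X b (k \<cdot>\<^bsub>A\<^esub> h) = RA a b k \<cdot>\<^bsub>B\<^esub> adjunct X a h"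
  unfolding adjunct_def
  by (simp add: RA_comp[OF h k] B_assoc[OF unt_hom[OF X] RA_hom[OF h] RA_hom[OF k]])

lemma adjunct_comp_LA:
  assumes f: "f \<in> Hom B X Y" and h: "h \<in> Hom A (LO Y) a"
  shows "adjunct X a (h \<cdot>\<^bsub>A\<^esub> LA X Y f) = adjunct Y a h \<cdot>\<^bsub>B\<^esub> f"
proof -
  note X = B_dom[OF f] and Y = B_cod[OF f]
  have "adjunct X a (h \<cdot>\<^bsub>A\<^esub> LA X Y f) =
      RA (LO Y) a h \<cdot>\<^bsub>B\<^esub> (RA (LO X) (LO Y) (LA X Y f) \<cdot>\<^bsub>B\<^esub> \<eta> X)"
    by (simp add: adjunct_comp[OF X LA_hom[OF f] h]) (simp add: adjunct_def)
  also have "\<dots> = adjunct Y a h \<cdot>\<^bsub>B\<^esub> f"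
    by (simp add: adjunct_def unt_nat[OF f, symmetric] B_assoc[OF f unt_hom[OF Y] RA_hom[OF h]])
  finally show ?thesis .
qed

lemma adjunct_id: "X \<in> Ob B \<Longrightarrow> adjunct X (LO X) (Id A (LO X)) = \<eta> X"
  by (simp add: adjunct_def RA_id LO_ob B_id_comp[OF unt_hom])

lemma adjunct_counit: "a \<in> Ob A \<Longrightarrow> adjunct (RO a) a (\<epsilon> a) = Id B (RO a)"
  by (simp add: adjunct_def RA_counit_unt)

lemma adjunct_counit_LA:
  assumes X: "X \<in> Ob B" and a: "a \<in> Ob A" and g: "g \<in> Hom B X (RO a)"
  shows "adjunct X a (\<epsilon> a \<cdot>\<^bsub>A\<^esub> LA X (RO a) g) = g"
  by (simp add: adjunct_comp_LA[OF g counit_hom[OF a]] adjunct_counit[OF a] B_id_comp[OF g])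

text \<open>
  Passing to adjuncts turns the coequalizer condition, whose two sides start at \<open>L R y\<close>, into an
  equation between arrows of \<open>B\<close> out of \<open>R y\<close>: the adjunct of \<open>h \<circ> \<epsilon>\<close> is \<open>R h\<close>. With \<open>p = \<pi>\<^sub>[\<^sub>n\<^sub>]\<close>
  the parallel pair is that of the adjoint decomposition, with \<open>p\<close> the identity that of the
  monadic tower.
\<close>

lemma coequalizes_iff_adjunct:
  assumes Z: "Z \<in> Ob B" and b: "b \<in> Hom B (RO y) Z"
    and p: "p \<in> Hom A (LO Z) y" and h: "h \<in> Hom A y a"
  shows "h \<cdot>\<^bsub>A\<^esub> (p \<cdot>\<^bsub>A\<^esub> LA (RO y) Z b) = h \<cdot>\<^bsub>A\<^esub> \<epsilon> y
    \<longleftrightarrow> adjunct Z a (h \<cdot>\<^bsub>A\<^esub> p) \<cdot>\<^bsub>B\<^esub> b = RA y a h"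
    (is "?l = ?r \<longleftrightarrow> _")
proof -
  note hp = A_comp[OF p h] and y = A_dom[OF h] and Lb = LA_hom[OF b]
  have l: "?l = (h \<cdot>\<^bsub>A\<^esub> p) \<cdot>\<^bsub>A\<^esub> LA (RO y) Z b" by (simp add: A_assoc[OF Lb p h])
  have "?l \<in> Hom A (LO (RO y)) a" using A_comp[OF Lb hp] l by simp
  moreover have "?r \<in> Hom A (LO (RO y)) a" using A_comp[OF counit_hom[OF y] h] .
  ultimately have "?l = ?r \<longleftrightarrow> adjunct (RO y) a ?l = adjunct (RO y) a ?r"
    using adjunct_inject[OF RO_ob[OF y]] by metis
  moreover have "adjunct (RO y) a ?l = adjunct Z a (h \<cdot>\<^bsub>A\<^esub> p) \<cdot>\<^bsub>B\<^esub> b"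
    by (simp add: l adjunct_comp_LA[OF b hp])
  moreover have "adjunct (RO y) a ?r = RA y a h"
    by (simp add: adjunct_comp[OF RO_ob[OF y] counit_hom[OF y] h] adjunct_counit[OF y]
        B_comp_id[OF RA_hom[OF h]])
  ultimately show ?thesis by simp
qed

end


section \<open>Lifting an adjunction along a coequalizer\<close>

text \<open>
  The last assumption of the locale says that arrows \<open>X \<rightarrow> R' a\<close> of \<open>C\<close> are, via adjuncts, the arrows
  \<open>L (lower X) \<rightarrow> a\<close> that coequalize \<open>u X\<close> and \<open>v X\<close>. So the adjunct of the
  coequalizer morphism is a universal arrow from \<open>X\<close> to \<open>R'\<close>.
\<close>

locale lifting = adjoint S for S :: "('oa, 'ma, ('ob, 'mb) tob, 'mb) adj" +
  fixes C :: "(('ob, 'mb) tob, 'mb) cat"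
    and R' :: "('oa, 'ma, ('ob, 'mb) tob, 'mb) ftor"
    and c :: "('ob, 'mb) tob \<Rightarrow> 'oa \<times> 'ma"
    and Z :: "('ob, 'mb) tob \<Rightarrow> 'oa"
    and u v :: "('ob, 'mb) tob \<Rightarrow> 'ma"
  assumes cat: "category C"
    and lower_ob: "X \<in> Ob C \<Longrightarrow> lower X \<in> Ob B"
    and lower_hom: "f \<in> Hom C X Y \<Longrightarrow> f \<in> Hom B (lower X) (lower Y)"
    and Comp_eq: "Comp C = Comp B"
    and Id_eq: "Id C X = Id B (lower X)"
    and R'_functor: "is_functor A C R'"
    and lower_R': "lower (FO R' a) = RO a"
    and FA_R': "FA R' = RA"
    and coeq: "X \<in> Ob C \<Longrightarrow> coequalizer A (Z X) (LO (lower X)) (u X) (v X) (fst (c X)) (snd (c X))"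
    and coequalizes_iff: "\<lbrakk>X \<in> Ob C; h \<in> Hom A (LO (lower X)) a\<rbrakk> \<Longrightarrow>
      h \<cdot>\<^bsub>A\<^esub> u X = h \<cdot>\<^bsub>A\<^esub> v X \<longleftrightarrow> adjunct (lower X) a h \<in> Hom C X (FO R' a)"
begin

abbreviation "Q X \<equiv> fst (c X)"
abbreviation "q X \<equiv> snd (c X)"

lemma q_hom: "X \<in> Ob C \<Longrightarrow> q X \<in> Hom A (LO (lower X)) (Q X)"
  using coeq unfolding coequalizer_def by blast

lemma adjunct_q: "X \<in> Ob C \<Longrightarrow> adjunct (lower X) (Q X) (q X) \<in> Hom C X (FO R' (Q X))"
  using coequalizes_iff[OF _ q_hom] coeq unfolding coequalizer_def by blast

lemma factor:
  assumes X: "X \<in> Ob C" and h: "h \<in> Hom A (LO (lower X)) a"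
    and t: "adjunct (lower X) a h \<in> Hom C X (FO R' a)"
  shows "\<exists>!k. k \<in> Hom A (Q X) a \<and> k \<cdot>\<^bsub>A\<^esub> q X = h"
  using coeq[OF X] coequalizes_iff[OF X h] h t unfolding coequalizer_def by blast

lemmas q_epi = coequalizer_epi[OF catA coeq]

abbreviation "T \<equiv> lift_adj S C R' c"

text \<open>
  The descriptions by \<open>THE\<close> of the left adjoint on arrows and, further below, of the counit are
  proper because the arrows to be factored through \<open>q\<close> have adjuncts in \<open>C\<close>: for the left adjoint,
  \<open>f\<close> followed by the adjunct of \<open>q Y\<close>, and for the counit, an identity.
\<close>

lemma lift_LA:
  assumes f: "f \<in> Hom C X Y"
  shows "FA (ladj T) X Y f \<in> Hom A (Q X) (Q Y)"
    and "FA (ladj T) X Y f \<cdot>\<^bsub>A\<^esub> q X = q Y \<cdot>\<^bsub>A\<^esub> LA (lower X) (lower Y) f"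
proof -
  note X = hom_dom[OF cat f] and Y = hom_cod[OF cat f] and lf = lower_hom[OF f]
  have "adjunct (lower X) (Q Y) (q Y \<cdot>\<^bsub>A\<^esub> LA (lower X) (lower Y) f) \<in> Hom C X (FO R' (Q Y))"
    using comp_hom[OF cat f adjunct_q[OF Y]] adjunct_comp_LA[OF lf q_hom[OF Y]]
    by (simp add: Comp_eq)
  from theI'[OF factor[OF X A_comp[OF LA_hom[OF lf] q_hom[OF Y]] this]]
  show "FA (ladj T) X Y f \<in> Hom A (Q X) (Q Y)"
    and "FA (ladj T) X Y f \<cdot>\<^bsub>A\<^esub> q X = q Y \<cdot>\<^bsub>A\<^esub> LA (lower X) (lower Y) f"
    by (simp_all add: lift_adj_def)
qed

lemma R'_ob: "a \<in> Ob A \<Longrightarrow> FO R' a \<in> Ob C"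
  using functor_ob[OF R'_functor] .

lemma lift_counit:
  assumes a: "a \<in> Ob A"
  shows "counit T a \<in> Hom A (Q (FO R' a)) a"
    and "counit T a \<cdot>\<^bsub>A\<^esub> q (FO R' a) = \<epsilon> a"
proof -
  have "adjunct (lower (FO R' a)) a (\<epsilon> a) \<in> Hom C (FO R' a) (FO R' a)"
    using id_hom[OF cat R'_ob[OF a]] by (simp add: lower_R' adjunct_counit[OF a] Id_eq)
  moreover have "\<epsilon> a \<in> Hom A (LO (lower (FO R' a))) a"
    using counit_hom[OF a] by (simp add: lower_R')
  ultimately have "\<exists>!k. k \<in> Hom A (Q (FO R' a)) a \<and> k \<cdot>\<^bsub>A\<^esub> q (FO R' a) = \<epsilon> a"
    using factor[OF R'_ob[OF a]] by blast
  from theI'[OF this]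
  show "counit T a \<in> Hom A (Q (FO R' a)) a" and "counit T a \<cdot>\<^bsub>A\<^esub> q (FO R' a) = \<epsilon> a"
    by (simp_all add: lift_adj_def)
qed

lemma lift_unt: "unt T X = adjunct (lower X) (Q X) (q X)"
  by (simp add: lift_adj_def adjunct_def)

lemma lift_ladj_functor: "is_functor C A (ladj T)"
proof -
  have LO: "FO (ladj T) X = Q X" for X by (simp add: lift_adj_def)
  have "FA (ladj T) X X (Id C X) = Id A (Q X)" if X: "X \<in> Ob C" for X
  proof (rule q_epi[OF X])
    note i = id_hom[OF cat X]
    show "FA (ladj T) X X (Id C X) \<in> Hom A (Q X) (Q X)" by (rule lift_LA[OF i])
    show "Id A (Q X) \<in> Hom A (Q X) (Q X)" using A_id A_cod q_hom[OF X] by blast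
    show "FA (ladj T) X X (Id C X) \<cdot>\<^bsub>A\<^esub> q X = Id A (Q X) \<cdot>\<^bsub>A\<^esub> q X"
      by (simp add: lift_LA(2)[OF i]) (simp add: Id_eq LA_id[OF lower_ob[OF X]] A_comp_id[OF q_hom[OF X]]
          A_id_comp[OF q_hom[OF X]])
  qed
  moreover have "FA (ladj T) X W (g \<cdot>\<^bsub>C\<^esub> f) = FA (ladj T) Y W g \<cdot>\<^bsub>A\<^esub> FA (ladj T) X Y f"
    if f: "f \<in> Hom C X Y" and g: "g \<in> Hom C Y W" for X Y W f g
  proof (rule q_epi[OF hom_dom[OF cat f]])
    note X = hom_dom[OF cat f] and Y = hom_cod[OF cat f] and W = hom_cod[OF cat g]
      and gf = comp_hom[OF cat f g] and F = lift_LA[OF f] and G = lift_LA[OF g]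
      and lf = LA_hom[OF lower_hom[OF f]] and lg = LA_hom[OF lower_hom[OF g]]
    show "FA (ladj T) X W (g \<cdot>\<^bsub>C\<^esub> f) \<in> Hom A (Q X) (Q W)" by (rule lift_LA[OF gf])
    show "FA (ladj T) Y W g \<cdot>\<^bsub>A\<^esub> FA (ladj T) X Y f \<in> Hom A (Q X) (Q W)"
      by (rule A_comp[OF F(1) G(1)])
    have "FA (ladj T) X W (g \<cdot>\<^bsub>C\<^esub> f) \<cdot>\<^bsub>A\<^esub> q X =
        (q W \<cdot>\<^bsub>A\<^esub> LA (lower Y) (lower W) g) \<cdot>\<^bsub>A\<^esub> LA (lower X) (lower Y) f"
      by (simp add: lift_LA(2)[OF gf] A_assoc[OF lf lg q_hom[OF W]])
        (simp add: Comp_eq LA_comp[OF lower_hom[OF f] lower_hom[OF g]])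
    also have "\<dots> = (FA (ladj T) Y W g \<cdot>\<^bsub>A\<^esub> q Y) \<cdot>\<^bsub>A\<^esub> LA (lower X) (lower Y) f" by (simp add: G)
    also have "\<dots> = FA (ladj T) Y W g \<cdot>\<^bsub>A\<^esub> (FA (ladj T) X Y f \<cdot>\<^bsub>A\<^esub> q X)"
      by (simp add: F A_assoc[OF lf q_hom[OF Y] G(1)])
    also have "\<dots> = (FA (ladj T) Y W g \<cdot>\<^bsub>A\<^esub> FA (ladj T) X Y f) \<cdot>\<^bsub>A\<^esub> q X"
      by (simp add: A_assoc[OF q_hom[OF X] F(1) G(1)])
    finally show "FA (ladj T) X W (g \<cdot>\<^bsub>C\<^esub> f) \<cdot>\<^bsub>A\<^esub> q X =
      (FA (ladj T) Y W g \<cdot>\<^bsub>A\<^esub> FA (ladj T) X Y f) \<cdot>\<^bsub>A\<^esub> q X" .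
  qed
  moreover have "Q X \<in> Ob A" if "X \<in> Ob C" for X using A_cod[OF q_hom[OF that]] .
  ultimately show ?thesis using lift_LA(1) unfolding is_functor_def LO by blast
qed

lemma lift_unt_nat:
  assumes f: "f \<in> Hom C X Y"
  shows "unt T Y \<cdot>\<^bsub>C\<^esub> f = FA R' (Q X) (Q Y) (FA (ladj T) X Y f) \<cdot>\<^bsub>C\<^esub> unt T X"
proof -
  note X = hom_dom[OF cat f] and Y = hom_cod[OF cat f] and F = lift_LA[OF f]
  have "unt T Y \<cdot>\<^bsub>C\<^esub> f = adjunct (lower X) (Q Y) (q Y \<cdot>\<^bsub>A\<^esub> LA (lower X) (lower Y) f)"
    by (simp add: lift_unt Comp_eq adjunct_comp_LA[OF lower_hom[OF f] q_hom[OF Y]])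
  also have "\<dots> = adjunct (lower X) (Q Y) (FA (ladj T) X Y f \<cdot>\<^bsub>A\<^esub> q X)" by (simp add: F)
  also have "\<dots> = FA R' (Q X) (Q Y) (FA (ladj T) X Y f) \<cdot>\<^bsub>C\<^esub> unt T X"
    by (simp add: lift_unt Comp_eq FA_R' adjunct_comp[OF lower_ob[OF X] q_hom[OF X] F(1)])
  finally show ?thesis .
qed

lemma lift_counit_LA_RA:
  assumes h: "h \<in> Hom A a b"
  shows "counit T b \<cdot>\<^bsub>A\<^esub> FA (ladj T) (FO R' a) (FO R' b) (RA a b h) = h \<cdot>\<^bsub>A\<^esub> counit T a"
proof -
  note a = A_dom[OF h] and b = A_cod[OF h]
  note Ra = R'_ob[OF a] and Rb = R'_ob[OF b] and ea = lift_counit[OF a] and eb = lift_counit[OF b]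
  have r: "RA a b h \<in> Hom C (FO R' a) (FO R' b)"
    using functor_hom[OF R'_functor h] by (simp add: FA_R')
  note F = lift_LA[OF r] and qa = q_hom[OF Ra] and qb = q_hom[OF Rb]
    and lr = LA_hom[OF lower_hom[OF r]]
  show ?thesis
  proof (rule q_epi[OF Ra A_comp[OF F(1) eb(1)] A_comp[OF ea(1) h]])
    have "(counit T b \<cdot>\<^bsub>A\<^esub> FA (ladj T) (FO R' a) (FO R' b) (RA a b h)) \<cdot>\<^bsub>A\<^esub> q (FO R' a)
      = (counit T b \<cdot>\<^bsub>A\<^esub> q (FO R' b)) \<cdot>\<^bsub>A\<^esub> LA (lower (FO R' a)) (lower (FO R' b)) (RA a b h)"
      by (simp add: A_assoc[OF qa F(1) eb(1)] F A_assoc[OF lr qb eb(1)])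
    also have "\<dots> = h \<cdot>\<^bsub>A\<^esub> \<epsilon> a" by (simp add: eb lower_R' counit_nat[OF h])
    also have "\<dots> = (h \<cdot>\<^bsub>A\<^esub> counit T a) \<cdot>\<^bsub>A\<^esub> q (FO R' a)" by (simp add: A_assoc[OF qa ea(1) h] ea)
    finally show "(counit T b \<cdot>\<^bsub>A\<^esub> FA (ladj T) (FO R' a) (FO R' b) (RA a b h)) \<cdot>\<^bsub>A\<^esub> q (FO R' a)
      = (h \<cdot>\<^bsub>A\<^esub> counit T a) \<cdot>\<^bsub>A\<^esub> q (FO R' a)" .
  qed
qed

lemma lift_triangle:
  assumes X: "X \<in> Ob C"
  shows "counit T (Q X) \<cdot>\<^bsub>A\<^esub> FA (ladj T) X (FO R' (Q X)) (unt T X) = Id A (Q X)"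
proof -
  note qX = q_hom[OF X]
  note Qo = A_cod[OF qX]
  note e = lift_counit[OF Qo]
  have t: "unt T X \<in> Hom C X (FO R' (Q X))" using adjunct_q[OF X] by (simp add: lift_unt)
  note F = lift_LA[OF t] and q' = q_hom[OF R'_ob[OF Qo]] and lt = LA_hom[OF lower_hom[OF t]]
  show ?thesis
  proof (rule q_epi[OF X A_comp[OF F(1) e(1)] A_id[OF Qo]])
    have "(counit T (Q X) \<cdot>\<^bsub>A\<^esub> FA (ladj T) X (FO R' (Q X)) (unt T X)) \<cdot>\<^bsub>A\<^esub> q X =
      (counit T (Q X) \<cdot>\<^bsub>A\<^esub> q (FO R' (Q X))) \<cdot>\<^bsub>A\<^esub> LA (lower X) (lower (FO R' (Q X))) (unt T X)"
      by (simp add: A_assoc[OF qX F(1) e(1)] F A_assoc[OF lt q' e(1)])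
    also have "\<dots> = q X"
      by (simp add: e lower_R' lift_unt counit_LA_adjunct[OF lower_ob[OF X] qX])
    finally show "(counit T (Q X) \<cdot>\<^bsub>A\<^esub> FA (ladj T) X (FO R' (Q X)) (unt T X)) \<cdot>\<^bsub>A\<^esub> q X =
      Id A (Q X) \<cdot>\<^bsub>A\<^esub> q X" by (simp add: A_id_comp[OF qX])
  qed
qed

lemma lift_triangle':
  assumes a: "a \<in> Ob A"
  shows "RA (Q (FO R' a)) a (counit T a) \<cdot>\<^bsub>C\<^esub> unt T (FO R' a) = Id C (FO R' a)"
proof -
  note Ra = R'_ob[OF a]
  show ?thesis
    using adjunct_comp[OF lower_ob[OF Ra] q_hom[OF Ra] lift_counit(1)[OF a]]
    by (simp add: lift_counit[OF a] lift_unt Comp_eq Id_eq lower_R' adjunct_counit[OF a])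
qed

theorem adjunction_lift_adj: "adjunction (lift_adj S C R' c)"
proof -
  have proj: "catA T = A" "catB T = C" "radj T = R'" "FO (ladj T) X = Q X" for X
    by (simp_all add: lift_adj_def)
  have "nat_trans C C id_ftor (R' \<circ>\<^sub>F ladj T) (unt T)"
    using adjunct_q lift_unt_nat
    by (simp add: nat_trans_def id_ftor_def comp_ftor_def proj lift_unt)
  moreover have "nat_trans A A (ladj T \<circ>\<^sub>F R') id_ftor (counit T)"
    using lift_counit(1) lift_counit_LA_RA
    by (simp add: nat_trans_def id_ftor_def comp_ftor_def proj FA_R')
  ultimately show ?thesis
    unfolding adjunction_def proj
    using catA cat lift_ladj_functor R'_functor lift_triangle lift_triangle' by (simp add: FA_R')
qed

end

text \<open>
  A common form of the step in the two towers. \<open>P\<close> supplies the functor \<open>R\<close> and the counit in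
  the parallel pair, \<open>S\<close> is the stage to be extended, and \<open>Obj\<close> consists of objects of \<open>S\<close> with an
  action \<open>R L\<^sub>S V \<rightarrow> U V\<close>. The adjoint decomposition takes for \<open>P\<close> the original adjunction and admits
  all actions; the monadic tower takes \<open>P = S\<close> and admits the Eilenberg-Moore algebras. The
  assumption on \<open>p\<close> expresses \<open>U \<eta>\<^sub>S = R p \<circ> \<eta> U\<close>.
\<close>

locale extension = P: adjoint P + S: adjoint S
  for P :: "('oa, 'ma, 'o, 'mb) adj" and S :: "('oa, 'ma, ('ob, 'mb) tob, 'mb) adj" +
  fixes U :: "('ob, 'mb) tob \<Rightarrow> 'o"
    and Obj :: "('ob, 'mb) tob set"
    and p :: "('ob, 'mb) tob \<Rightarrow> 'ma"
    and c :: "('ob, 'mb) tob \<Rightarrow> 'oa \<times> 'ma"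
  assumes catA_eq: "S.A = P.A"
    and Comp_eq: "Comp S.B = Comp P.B"
    and Id_eq: "Id S.B X = Id P.B (U X)"
    and U_hom: "f \<in> Hom S.B X Y \<Longrightarrow> f \<in> Hom P.B (U X) (U Y)"
    and U_RO: "U (S.RO a) = P.RO a"
    and RA_eq: "S.RA = P.RA"
    and p_hom: "X \<in> Ob S.B \<Longrightarrow> p X \<in> Hom P.A (P.LO (U X)) (S.LO X)"
    and adjunct_p: "X \<in> Ob S.B \<Longrightarrow> P.adjunct (U X) (S.LO X) (p X) = S.\<eta> X"
    and Obj_lower: "X \<in> Obj \<Longrightarrow> lower X \<in> Ob S.B"
    and Obj_action: "X \<in> Obj \<Longrightarrow> action X \<in> Hom P.B (P.RO (S.LO (lower X))) (U (lower X))"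
    and Obj_RO: "a \<in> Ob P.A \<Longrightarrow> Ext (S.RO a) (P.RA (S.LO (S.RO a)) a (S.\<epsilon> a)) \<in> Obj"
    and coeq: "X \<in> Obj \<Longrightarrow>
      coequalizer P.A (P.LO (P.RO (S.LO (lower X)))) (S.LO (lower X))
        (p (lower X) \<cdot>\<^bsub>P.A\<^esub> P.LA (P.RO (S.LO (lower X))) (U (lower X)) (action X))
        (P.\<epsilon> (S.LO (lower X))) (fst (c X)) (snd (c X))"
begin

definition T :: "('ob, 'mb) tob \<Rightarrow> ('ob, 'mb) tob \<Rightarrow> 'mb \<Rightarrow> 'mb" where
  "T X Y f = P.RA (S.LO X) (S.LO Y) (S.LA X Y f)"

definition C :: "(('ob, 'mb) tob, 'mb) cat" where
  "C = \<lparr>Ob = Obj,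
     Hom = \<lambda>X Y. {f. X \<in> Obj \<and> Y \<in> Obj \<and> f \<in> Hom S.B (lower X) (lower Y) \<and>
       f \<cdot>\<^bsub>P.B\<^esub> action X = action Y \<cdot>\<^bsub>P.B\<^esub> T (lower X) (lower Y) f},
     Id = \<lambda>X. Id S.B (lower X),
     Comp = Comp S.B\<rparr>"

definition R' :: "('oa, 'ma, ('ob, 'mb) tob, 'mb) ftor" where
  "R' = \<lparr>FO = \<lambda>a. Ext (S.RO a) (P.RA (S.LO (S.RO a)) a (S.\<epsilon> a)), FA = S.RA\<rparr>"

lemma T_hom: "f \<in> Hom S.B X Y \<Longrightarrow> T X Y f \<in> Hom P.B (P.RO (S.LO X)) (P.RO (S.LO Y))"
  unfolding T_def by (rule P.RA_hom[OF S.LA_hom[unfolded catA_eq]])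

lemma T_comp:
  assumes "f \<in> Hom S.B X Y" "g \<in> Hom S.B Y Z"
  shows "T X Z (g \<cdot>\<^bsub>P.B\<^esub> f) = T Y Z g \<cdot>\<^bsub>P.B\<^esub> T X Y f"
  using S.LA_comp[OF assms] P.RA_comp[OF assms[THEN S.LA_hom, unfolded catA_eq]]
  unfolding T_def by (simp add: catA_eq Comp_eq)

lemma T_id: "X \<in> Ob S.B \<Longrightarrow> T X X (Id S.B X) = Id P.B (P.RO (S.LO X))"
  using S.LO_ob[of X] unfolding T_def by (simp add: S.LA_id catA_eq P.RA_id)

lemma C_hom_iff: "f \<in> Hom C X Y \<longleftrightarrow> X \<in> Obj \<and> Y \<in> Obj \<and> f \<in> Hom S.B (lower X) (lower Y) \<and>
    f \<cdot>\<^bsub>P.B\<^esub> action X = action Y \<cdot>\<^bsub>P.B\<^esub> T (lower X) (lower Y) f"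
  by (simp add: C_def)

lemma C_comp_hom:
  assumes f: "f \<in> Hom C X Y" and g: "g \<in> Hom C Y Z"
  shows "g \<cdot>\<^bsub>P.B\<^esub> f \<in> Hom C X Z"
proof -
  have X: "X \<in> Obj" and Y: "Y \<in> Obj" and Z: "Z \<in> Obj"
    and f': "f \<in> Hom S.B (lower X) (lower Y)" and g': "g \<in> Hom S.B (lower Y) (lower Z)"
    and fa: "f \<cdot>\<^bsub>P.B\<^esub> action X = action Y \<cdot>\<^bsub>P.B\<^esub> T (lower X) (lower Y) f"
    and ga: "g \<cdot>\<^bsub>P.B\<^esub> action Y = action Z \<cdot>\<^bsub>P.B\<^esub> T (lower Y) (lower Z) g"
    using f g unfolding C_hom_iff by auto
  note Uf = U_hom[OF f'] and Ug = U_hom[OF g']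
  have "(g \<cdot>\<^bsub>P.B\<^esub> f) \<cdot>\<^bsub>P.B\<^esub> action X = (g \<cdot>\<^bsub>P.B\<^esub> action Y) \<cdot>\<^bsub>P.B\<^esub> T (lower X) (lower Y) f"
    by (simp add: P.B_assoc[OF Obj_action[OF X] Uf Ug] P.B_assoc[OF T_hom[OF f'] Obj_action[OF Y] Ug] fa)
  also have "\<dots> = action Z \<cdot>\<^bsub>P.B\<^esub> T (lower X) (lower Z) (g \<cdot>\<^bsub>P.B\<^esub> f)"
    by (simp add: ga T_comp[OF f' g'] P.B_assoc[OF T_hom[OF f'] T_hom[OF g'] Obj_action[OF Z]])
  finally show ?thesis
    using X Z S.B_comp[OF f' g'] by (simp add: C_hom_iff Comp_eq)
qed

lemma C_id_hom:
  assumes X: "X \<in> Obj"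
  shows "Id S.B (lower X) \<in> Hom C X X"
  using X S.B_id[OF Obj_lower[OF X]] P.B_id_comp[OF Obj_action[OF X]]
    P.B_comp_id[OF Obj_action[OF X]] T_id[OF Obj_lower[OF X]]
  by (simp add: C_hom_iff Id_eq)

lemma C_category: "category C"
proof -
  have Ob: "Ob C = Obj" and Comp: "Comp C = Comp P.B" and Id: "Id C X = Id S.B (lower X)" for X
    by (simp_all add: C_def Comp_eq)
  show ?thesis
    unfolding category_def Ob Comp Id
  proof (intro conjI allI ballI)
    show "Hom C X Y \<noteq> {} \<longrightarrow> X \<in> Obj \<and> Y \<in> Obj" for X Y by (auto simp: C_hom_iff)
  next
    fix X Y f assume "f \<in> Hom C X Y"
    then have "f \<in> Hom S.B (lower X) (lower Y)" by (simp add: C_hom_iff)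
    then show "f \<cdot>\<^bsub>P.B\<^esub> Id S.B (lower X) = f" "Id S.B (lower Y) \<cdot>\<^bsub>P.B\<^esub> f = f"
      by (simp_all add: S.B_comp_id[unfolded Comp_eq] S.B_id_comp[unfolded Comp_eq])
  next
    fix W X Y Z f g h assume "f \<in> Hom C W X" "g \<in> Hom C X Y" "h \<in> Hom C Y Z"
    then show "h \<cdot>\<^bsub>P.B\<^esub> (g \<cdot>\<^bsub>P.B\<^esub> f) = h \<cdot>\<^bsub>P.B\<^esub> g \<cdot>\<^bsub>P.B\<^esub> f"
      using S.B_assoc[unfolded Comp_eq] by (auto simp: C_hom_iff)
  qed (auto intro: C_id_hom C_comp_hom)
qed

text \<open>
  The action of \<open>R' a\<close> is \<open>R \<epsilon>\<^sub>S\<close>, so compatibility of \<open>g : X \<rightarrow> R' a\<close> with the actions involves \<open>R\<close>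
  applied to \<open>\<epsilon>\<^sub>S \<circ> L\<^sub>S g\<close>, which is the arrow with adjunct \<open>g\<close>.
\<close>

lemma C_adjunct_hom_iff:
  assumes X: "X \<in> Obj" and a: "a \<in> Ob P.A" and g: "g \<in> Hom S.B (lower X) (S.RO a)"
  shows "g \<in> Hom C X (FO R' a) \<longleftrightarrow>
    g \<cdot>\<^bsub>P.B\<^esub> action X = P.RA (S.LO (lower X)) a (S.\<epsilon> a \<cdot>\<^bsub>P.A\<^esub> S.LA (lower X) (S.RO a) g)"
  using X Obj_RO[OF a] g
    P.RA_comp[OF S.LA_hom[OF g, unfolded catA_eq] S.counit_hom[unfolded catA_eq, OF a]]
  by (simp add: C_hom_iff R'_def T_def)

lemma R'_is_functor: "is_functor P.A C R'"
proof -
  have "S.RA a b h \<in> Hom C (FO R' a) (FO R' b)" if h: "h \<in> Hom P.A a b" for a b h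
  proof -
    note a = P.A_dom[OF h] and b = P.A_cod[OF h]
    have Ra: "FO R' a \<in> Obj" using Obj_RO[OF a] by (simp add: R'_def)
    have g: "S.RA a b h \<in> Hom S.B (lower (FO R' a)) (S.RO b)"
      using S.RA_hom[unfolded catA_eq, OF h] by (simp add: R'_def)
    show ?thesis
      unfolding C_adjunct_hom_iff[OF Ra b g]
      by (simp add: R'_def S.counit_nat[unfolded catA_eq RA_eq, OF h] RA_eq
          P.RA_comp[OF S.counit_hom[unfolded catA_eq, OF a] h])
  qed
  moreover have "FO R' a \<in> Ob C" if "a \<in> Ob P.A" for a
    using Obj_RO[OF that] by (simp add: R'_def C_def)
  moreover have "FA R' = S.RA" "Id C (FO R' a) = Id S.B (S.RO a)" "Comp C = Comp S.B" for a
    by (simp_all add: R'_def C_def)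
  ultimately show ?thesis
    unfolding is_functor_def
    using S.RA_id[unfolded catA_eq] S.RA_comp[unfolded catA_eq] by simp
qed

lemma coequalizes_iff:
  assumes X: "X \<in> Obj" and h: "h \<in> Hom P.A (S.LO (lower X)) a"
  shows "h \<cdot>\<^bsub>P.A\<^esub> (p (lower X) \<cdot>\<^bsub>P.A\<^esub> P.LA (P.RO (S.LO (lower X))) (U (lower X)) (action X)) =
      h \<cdot>\<^bsub>P.A\<^esub> P.\<epsilon> (S.LO (lower X)) \<longleftrightarrow> S.adjunct (lower X) a h \<in> Hom C X (FO R' a)"
proof -
  note lX = Obj_lower[OF X] and a = P.A_cod[OF h]
  note U = P.B_dom[OF U_hom[OF S.unt_hom[OF lX]]]
  have "P.adjunct (U (lower X)) a (h \<cdot>\<^bsub>P.A\<^esub> p (lower X)) = S.adjunct (lower X) a h"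
    by (simp add: P.adjunct_comp[OF U p_hom[OF lX] h] adjunct_p[OF lX] S.adjunct_def RA_eq Comp_eq)
  with P.coequalizes_iff_adjunct[OF U Obj_action[OF X] p_hom[OF lX] h]
  show ?thesis
    using C_adjunct_hom_iff[OF X a S.adjunct_hom[OF lX h[folded catA_eq]]]
      S.counit_LA_adjunct[OF lX h[folded catA_eq]]
    by (simp add: catA_eq)
qed

lemma lifting:
  "lifting S C R' c (\<lambda>X. P.LO (P.RO (S.LO (lower X))))
     (\<lambda>X. p (lower X) \<cdot>\<^bsub>P.A\<^esub> P.LA (P.RO (S.LO (lower X))) (U (lower X)) (action X))
     (\<lambda>X. P.\<epsilon> (S.LO (lower X)))"
proof -
  have sel: "Ob C = Obj" "Comp C = Comp S.B" "Id C X = Id S.B (lower X)"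
    "lower (FO R' a) = S.RO a" "FA R' = S.RA" for X a
    by (simp_all add: C_def R'_def)
  show ?thesis
    by unfold_locales
      (simp_all add: sel C_category Obj_lower R'_is_functor catA_eq coeq coequalizes_iff C_hom_iff)
qed

end


section \<open>The stages of the towers\<close>

lemma FA_forget [simp]: "FA (forget n) X Y f = f"
  by (induction n arbitrary: X Y) (simp_all add: comp_ftor_def drop_ftor_def)

lemma FO_forget_Suc [simp]: "FO (forget (Suc n)) X = FO (forget n) (lower X)"
  by (simp add: comp_ftor_def drop_ftor_def)

\<comment> \<open>Unfolding \<open>forget (Suc n)\<close> as a composite would hide the redex of the rule above.\<close>
declare forget.simps(2) [simp del]

text \<open>
  What both towers have in common at stage \<open>n\<close>: the stage differs from \<open>B\<close> only in its objects and
  in the choice of admitted arrows.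
\<close>

locale stage = P: adjoint P + adjoint S
  for P :: "('oa, 'ma, 'ob, 'mb) adj" and n :: nat and S :: "('oa, 'ma, ('ob, 'mb) tob, 'mb) adj" +
  assumes catA_eq: "A = P.A"
    and Comp_eq: "Comp B = Comp P.B"
    and Id_eq: "Id B X = Id P.B (FO (forget n) X)"
    and U_hom: "f \<in> Hom B X Y \<Longrightarrow> f \<in> Hom P.B (FO (forget n) X) (FO (forget n) Y)"
    and U_RO: "FO (forget n) (RO a) = P.RO a"
    and RA_eq: "RA = P.RA"

lemma stage_0:
  assumes "adjunction P"
  shows "stage P 0 (base_adj P)"
proof -
  interpret P: adjoint P by standard fact
  have "category (base_cat P.B)"
    unfolding category_def base_cat_def
    using P.B_id P.B_comp P.B_comp_id P.B_id_comp P.B_assoc by auto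
  then have "adjunction (base_adj P)"
    unfolding adjunction_def base_adj_def is_functor_def nat_trans_def base_cat_def
    by (auto simp: comp_ftor_def id_ftor_def P.catA P.LO_ob P.LA_hom P.LA_id P.LA_comp
        P.RO_ob P.RA_hom P.RA_id P.RA_comp P.unt_hom P.unt_nat P.counit_hom P.counit_nat
        P.counit_LA_unt P.RA_counit_unt dest: P.A_dom P.A_cod)
  then show ?thesis
    by unfold_locales (auto simp: base_adj_def base_cat_def comp_ftor_def)
qed

lemma stage_Suc:
  assumes "stage P n S" and "lifting S C R' c Z u v"
  shows "stage P (Suc n) (lift_adj S C R' c)"
proof -
  interpret st: stage P n S by fact
  interpret lifting S C R' c Z u v by fact
  have proj: "catA T = st.A" "catB T = C" "radj T = R'"
    by (simp_all add: lift_adj_def)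
  show ?thesis
    using adjunction_lift_adj lower_hom
    by unfold_locales
      (auto simp: proj st.catA_eq st.Comp_eq Comp_eq st.Id_eq Id_eq st.U_hom st.U_RO st.RA_eq
        lower_R' FA_R')
qed

lemma EM_Ob_iff:
  "X \<in> Ob (adj_EM S) \<longleftrightarrow> (\<exists>V a. X = Ext V a \<and> V \<in> Ob (catB S) \<and>
     a \<in> Hom (catB S) (FO (radj S) (FO (ladj S) V)) V \<and>
     a \<cdot>\<^bsub>catB S\<^esub> unt S V = Id (catB S) V \<and>
     a \<cdot>\<^bsub>catB S\<^esub> FA (radj S) (FO (ladj S) (FO (radj S) (FO (ladj S) V))) (FO (ladj S) V)
       (FA (ladj S) (FO (radj S) (FO (ladj S) V)) V a) =
     a \<cdot>\<^bsub>catB S\<^esub> FA (radj S) (FO (ladj S) (FO (radj S) (FO (ladj S) V))) (FO (ladj S) V)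
       (counit S (FO (ladj S) V)))"
  by (auto simp: adj_EM_def EM_cat_def EM_Ob_def comp_ftor_def)

lemma EM_hom_iff:
  "f \<in> Hom (adj_EM S) X Y \<longleftrightarrow> X \<in> Ob (adj_EM S) \<and> Y \<in> Ob (adj_EM S) \<and>
     f \<in> Hom (catB S) (lower X) (lower Y) \<and>
     f \<cdot>\<^bsub>catB S\<^esub> action X = action Y \<cdot>\<^bsub>catB S\<^esub>
       FA (radj S) (FO (ladj S) (lower X)) (FO (ladj S) (lower Y)) (FA (ladj S) (lower X) (lower Y) f)"
  by (auto simp: adj_EM_def EM_cat_def comp_ftor_def)

lemma dec_Ob_iff:
  "X \<in> dec_Ob P n S \<longleftrightarrow> (\<exists>V b. X = Ext V b \<and> V \<in> Ob (catB S) \<and>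
     b \<in> Hom (catB P) (FO (radj P) (FO (ladj S) V)) (FO (forget n) V))"
  by (auto simp: dec_Ob_def comp_ftor_def)

lemma dec_hom_iff:
  "f \<in> Hom (dec_cat P n S) X Y \<longleftrightarrow> X \<in> dec_Ob P n S \<and> Y \<in> dec_Ob P n S \<and>
     f \<in> Hom (catB S) (lower X) (lower Y) \<and>
     f \<cdot>\<^bsub>catB P\<^esub> action X = action Y \<cdot>\<^bsub>catB P\<^esub>
       FA (radj P) (FO (ladj S) (lower X)) (FO (ladj S) (lower Y)) (FA (ladj S) (lower X) (lower Y) f)"
  by (auto simp: dec_cat_def comp_ftor_def)

lemma chosen_coequalizer:
  "\<lbrakk>chosen_coequalizers C cq; f \<in> Hom C X Y; g \<in> Hom C X Y\<rbrakk> \<Longrightarrow>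
    coequalizer C X Y f g (fst (cq X Y f g)) (snd (cq X Y f g))"
  unfolding chosen_coequalizers_def by blast

lemma lifting_EM:
  assumes "adjunction S" and cq: "chosen_coequalizers (catA S) cq"
  shows "\<exists>Z u v. lifting S (adj_EM S) (comparison S) (mon_coeq cq S) Z u v"
proof -
  interpret adjoint S by standard fact
  have Ext_R: "Ext (RO a) (RA (LO (RO a)) a (\<epsilon> a)) \<in> Ob (adj_EM S)" if a: "a \<in> Ob A" for a
  proof -
    note e = counit_hom[OF a] and Ra = RO_ob[OF a]
    note Le = LA_hom[OF RA_hom[OF e]] and e' = counit_hom[OF LO_ob[OF Ra]]
    show ?thesis
      using RA_hom[OF e] RA_counit_unt[OF a] Ra RA_comp[OF Le e] RA_comp[OF e' e] counit_nat[OF e]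
      by (simp add: EM_Ob_iff)
  qed
  have Obj: "lower X \<in> Ob B" "action X \<in> Hom B (RO (LO (lower X))) (lower X)"
    if "X \<in> Ob (adj_EM S)" for X
    using that by (auto simp: EM_Ob_iff)
  \<comment> \<open>The parallel pair of the monadic tower is the general one with \<open>p\<close> the identity, whose adjunct
    is the unit.\<close>
  interpret extension S S "\<lambda>X. X" "Ob (adj_EM S)" "\<lambda>X. Id A (LO X)" "mon_coeq cq S"
  proof unfold_locales
    fix X assume X: "X \<in> Ob (adj_EM S)"
    note La = LA_hom[OF Obj(2)[OF X]] and e = counit_hom[OF LO_ob[OF Obj(1)[OF X]]]
    from chosen_coequalizer[OF cq La e]
    show "coequalizer A (LO (RO (LO (lower X)))) (LO (lower X))
        (Id A (LO (lower X)) \<cdot>\<^bsub>A\<^esub> LA (RO (LO (lower X))) (lower X) (action X))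
        (\<epsilon> (LO (lower X))) (fst (mon_coeq cq S X)) (snd (mon_coeq cq S X))"
      by (simp add: A_id_comp[OF La] mon_coeq_def comp_ftor_def)
  qed (simp_all add: Obj Ext_R A_id LO_ob adjunct_id)
  have "C = adj_EM S"
    unfolding C_def T_def by (simp add: adj_EM_def EM_cat_def comp_ftor_def)
  moreover have "R' = comparison S"
    by (simp add: R'_def comparison_def comp_ftor_def)
  ultimately show ?thesis using lifting by auto
qed

lemma stage_mon_adj:
  assumes "adjunction P" and "chosen_coequalizers (catA P) cq"
  shows "stage P n (mon_adj P cq n)"
proof (induction n)
  case 0
  then show ?case using stage_0[OF assms(1)] by simp
next
  case (Suc n)
  interpret stage P n "mon_adj P cq n" by fact
  have "chosen_coequalizers A cq" using assms(2) by (simp add: catA_eq)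
  from lifting_EM[OF adjunction this] show ?case
    using stage_Suc[OF Suc] by (auto simp: Let_def)
qed

text \<open>
  Here \<open>p\<close> is \<open>\<pi>\<^sub>[\<^sub>n\<^sub>]\<close>, determined by its adjunct \<open>\<eta>\<^sub>[\<^sub>n\<^sub>]\<close> in the original adjunction. The relation
  passes to the next stage because the recursions for \<open>\<pi>\<^sub>[\<^sub>n\<^sub>]\<close> and \<open>\<eta>\<^sub>[\<^sub>n\<^sub>]\<close> both compose
  with the coequalizer morphism.
\<close>

locale dec_stage = stage P n S
  for P :: "('oa, 'ma, 'ob, 'mb) adj" and n :: nat and S :: "('oa, 'ma, ('ob, 'mb) tob, 'mb) adj" +
  fixes p :: "('ob, 'mb) tob \<Rightarrow> 'ma"
  assumes p_hom: "X \<in> Ob B \<Longrightarrow> p X \<in> Hom P.A (P.LO (FO (forget n) X)) (LO X)"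
    and adjunct_p: "X \<in> Ob B \<Longrightarrow> P.adjunct (FO (forget n) X) (LO X) (p X) = \<eta> X"

lemma (in dec_stage) lifting_dec:
  assumes cq: "chosen_coequalizers P.A cq"
  shows "\<exists>Z u v. lifting S (dec_cat P n S) (dec_R P S) (dec_coeq P cq n S p) Z u v"
proof -
  have Obj: "lower X \<in> Ob B" "action X \<in> Hom P.B (P.RO (LO (lower X))) (FO (forget n) (lower X))"
    if "X \<in> dec_Ob P n S" for X
    using that by (auto simp: dec_Ob_iff)
  interpret ext: extension P S "FO (forget n)" "dec_Ob P n S" p "dec_coeq P cq n S p"
  proof unfold_locales
    fix a assume a: "a \<in> Ob P.A"
    show "Ext (RO a) (P.RA (LO (RO a)) a (\<epsilon> a)) \<in> dec_Ob P n S"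
      using RO_ob[unfolded catA_eq, OF a] P.RA_hom[OF counit_hom[unfolded catA_eq, OF a]]
      by (simp add: dec_Ob_iff U_RO)
  next
    fix X assume X: "X \<in> dec_Ob P n S"
    note lX = Obj(1)[OF X]
    note pa = P.A_comp[OF P.LA_hom[OF Obj(2)[OF X]] p_hom[OF lX]]
      and e = P.counit_hom[OF LO_ob[unfolded catA_eq, OF lX]]
    from chosen_coequalizer[OF cq pa e]
    show "coequalizer P.A (P.LO (P.RO (LO (lower X)))) (LO (lower X))
        (p (lower X) \<cdot>\<^bsub>P.A\<^esub> P.LA (P.RO (LO (lower X))) (FO (forget n) (lower X)) (action X))
        (P.\<epsilon> (LO (lower X))) (fst (dec_coeq P cq n S p X)) (snd (dec_coeq P cq n S p X))"
      by (simp add: dec_coeq_def comp_ftor_def)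
  qed (simp_all add: catA_eq Comp_eq Id_eq U_hom U_RO RA_eq p_hom adjunct_p Obj)
  have "ext.C = dec_cat P n S"
    by (simp add: ext.C_def dec_cat_def ext.T_def fun_eq_iff comp_ftor_def)
  moreover have "ext.R' = dec_R P S"
    by (simp add: ext.R'_def dec_R_def comp_ftor_def)
  ultimately show ?thesis using ext.lifting by auto
qed

lemma dec_stage_Suc:
  assumes "dec_stage P n S p" and "lifting S C R' c Z u v"
  shows "dec_stage P (Suc n) (lift_adj S C R' c) (\<lambda>X. snd (c X) \<cdot>\<^bsub>catA P\<^esub> p (lower X))"
proof -
  interpret st: dec_stage P n S p by fact
  interpret lifting S C R' c Z u v by fact
  interpret st': stage P "Suc n" T using stage_Suc[OF st.stage_axioms assms(2)] .
  have proj: "catB T = C" "FO (ladj T) X = Q X" for X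
    by (simp_all add: lift_adj_def)
  show ?thesis
  proof unfold_locales
    fix X assume "X \<in> Ob (catB T)"
    then have X: "X \<in> Ob C" by (simp add: proj)
    note lX = lower_ob[OF X]
    note U = st.P.B_dom[OF st.U_hom[OF st.unt_hom[OF lX]]]
    note p = st.p_hom[OF lX] and q = q_hom[OF X, unfolded st.catA_eq]
    show "q X \<cdot>\<^bsub>st.P.A\<^esub> p (lower X) \<in> Hom st.P.A (st.P.LO (FO (forget (Suc n)) X)) (FO (ladj T) X)"
      using st.P.A_comp[OF p q] by (simp add: proj)
    show "st.P.adjunct (FO (forget (Suc n)) X) (FO (ladj T) X) (q X \<cdot>\<^bsub>st.P.A\<^esub> p (lower X)) = unt T X"
      by (simp add: proj st.P.adjunct_comp[OF U p q] st.adjunct_p[OF lX] lift_unt st.adjunct_def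
          st.RA_eq st.Comp_eq)
  qed
qed

lemma dec_stage_decomp:
  assumes "adjunction P" and "chosen_coequalizers (catA P) cq"
  shows "dec_stage P n (dec_adj P cq n) (snd (decomp P cq n))"
proof (induction n)
  case 0
  interpret stage P 0 "base_adj P" by (rule stage_0[OF assms(1)])
  have "dec_stage P 0 (base_adj P) (\<lambda>X. Id (catA P) (FO (ladj P) (root X)))"
    by unfold_locales
      (auto simp: base_adj_def base_cat_def comp_ftor_def P.LO_ob P.A_id P.adjunct_id)
  then show ?case by (simp add: dec_adj_def)
next
  case (Suc n)
  obtain S p where Sp: "decomp P cq n = (S, p)" by fastforce
  interpret dec_stage P n S p using Suc by (simp add: Sp dec_adj_def)
  from lifting_dec[OF assms(2)] show ?case
    using dec_stage_Suc[OF dec_stage_axioms] by (auto simp: Let_def Sp dec_adj_def)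
qed


section \<open>The comparison functors\<close>

text \<open>
  \<open>\<Lambda>\<close> is the object part of \<open>\<Lambda>\<^sub>n\<close>; its arrow part is the identity on arrows of \<open>B\<close>, so equality of the
  hom-sets means that it is a fully faithful functor.
\<close>

locale tower_comparison = P: adjoint P + M: stage P n M + D: stage P n D
  for P :: "('oa, 'ma, 'ob, 'mb) adj" and n :: nat
    and M D :: "('oa, 'ma, ('ob, 'mb) tob, 'mb) adj" +
  fixes \<Lambda> :: "('ob, 'mb) tob \<Rightarrow> ('ob, 'mb) tob"
  assumes U_\<Lambda>: "FO (forget n) (\<Lambda> X) = FO (forget n) X"
    and \<Lambda>_ob: "X \<in> Ob M.B \<Longrightarrow> \<Lambda> X \<in> Ob D.B"
    and \<Lambda>_RO: "a \<in> Ob P.A \<Longrightarrow> \<Lambda> (M.RO a) = D.RO a"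
    and \<Lambda>_Hom: "\<lbrakk>X \<in> Ob M.B; Y \<in> Ob M.B\<rbrakk> \<Longrightarrow> Hom D.B (\<Lambda> X) (\<Lambda> Y) = Hom M.B X Y"
begin

text \<open>
  The arrows between \<open>L\<^sub>[\<^sub>n\<^sub>] \<Lambda>\<^sub>n V\<close> and \<open>L\<^sub>n V\<close> whose adjuncts are the two units. Both
  units are arrows \<open>V \<rightarrow> R\<^sub>n a\<close> in \<open>B\<^sub>n\<close> and arrows \<open>\<Lambda>\<^sub>n V \<rightarrow> R\<^sub>[\<^sub>n\<^sub>] a\<close> in \<open>B\<^sub>[\<^sub>n\<^sub>]\<close> alike, so they can be
  transposed on either side.
\<close>

definition lam :: "('ob, 'mb) tob \<Rightarrow> 'ma" where
  "lam V = D.\<epsilon> (M.LO V) \<cdot>\<^bsub>P.A\<^esub> D.LA (\<Lambda> V) (\<Lambda> (M.RO (M.LO V))) (M.\<eta> V)"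

definition lam_inv :: "('ob, 'mb) tob \<Rightarrow> 'ma" where
  "lam_inv V = M.\<epsilon> (D.LO (\<Lambda> V)) \<cdot>\<^bsub>P.A\<^esub> M.LA V (M.RO (D.LO (\<Lambda> V))) (D.\<eta> (\<Lambda> V))"

lemma M_LO_ob: "V \<in> Ob M.B \<Longrightarrow> M.LO V \<in> Ob P.A"
  using M.LO_ob[unfolded M.catA_eq] .

lemma D_LO_ob: "V \<in> Ob M.B \<Longrightarrow> D.LO (\<Lambda> V) \<in> Ob P.A"
  using D.LO_ob[OF \<Lambda>_ob, unfolded D.catA_eq] .

lemma RO_hom_iff: "\<lbrakk>V \<in> Ob M.B; a \<in> Ob P.A\<rbrakk> \<Longrightarrow> Hom D.B (\<Lambda> V) (D.RO a) = Hom M.B V (M.RO a)"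
  using \<Lambda>_Hom[of V "M.RO a"] \<Lambda>_RO M.RO_ob[unfolded M.catA_eq] by metis

lemma
  assumes V: "V \<in> Ob M.B"
  shows lam_hom: "lam V \<in> Hom P.A (D.LO (\<Lambda> V)) (M.LO V)"
    and adjunct_lam: "D.adjunct (\<Lambda> V) (M.LO V) (lam V) = M.\<eta> V"
proof -
  note a = M_LO_ob[OF V]
  have e: "M.\<eta> V \<in> Hom D.B (\<Lambda> V) (D.RO (M.LO V))"
    using M.unt_hom[OF V] RO_hom_iff[OF V a] by simp
  show "lam V \<in> Hom P.A (D.LO (\<Lambda> V)) (M.LO V)"
    using P.A_comp[OF D.LA_hom[unfolded D.catA_eq, OF e] D.counit_hom[unfolded D.catA_eq, OF a]]
    by (simp add: lam_def \<Lambda>_RO[OF a])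
  show "D.adjunct (\<Lambda> V) (M.LO V) (lam V) = M.\<eta> V"
    using D.adjunct_counit_LA[unfolded D.catA_eq, OF \<Lambda>_ob[OF V] a e]
    by (simp add: lam_def \<Lambda>_RO[OF a])
qed

lemma
  assumes V: "V \<in> Ob M.B"
  shows lam_inv_hom: "lam_inv V \<in> Hom P.A (M.LO V) (D.LO (\<Lambda> V))"
    and adjunct_lam_inv: "M.adjunct V (D.LO (\<Lambda> V)) (lam_inv V) = D.\<eta> (\<Lambda> V)"
proof -
  note a = D_LO_ob[OF V]
  have e: "D.\<eta> (\<Lambda> V) \<in> Hom M.B V (M.RO (D.LO (\<Lambda> V)))"
    using D.unt_hom[OF \<Lambda>_ob[OF V]] RO_hom_iff[OF V a] by simp
  show "lam_inv V \<in> Hom P.A (M.LO V) (D.LO (\<Lambda> V))"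
    using P.A_comp[OF M.LA_hom[unfolded M.catA_eq, OF e] M.counit_hom[unfolded M.catA_eq, OF a]]
    by (simp add: lam_inv_def)
  show "M.adjunct V (D.LO (\<Lambda> V)) (lam_inv V) = D.\<eta> (\<Lambda> V)"
    using M.adjunct_counit_LA[unfolded M.catA_eq, OF V a e]
    by (simp add: lam_inv_def)
qed

text \<open>
  On adjuncts, composing with \<open>lam\<close> or \<open>lam_inv\<close> carries one unit to the other, so the composites have
  the adjuncts of identities.
\<close>

lemma lam_lam_inv:
  assumes V: "V \<in> Ob M.B"
  shows "lam V \<cdot>\<^bsub>P.A\<^esub> lam_inv V = Id P.A (M.LO V)"
proof (rule M.adjunct_inject[unfolded M.catA_eq, OF V])
  note i = lam_hom[OF V] and j = lam_inv_hom[OF V]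
  show "lam V \<cdot>\<^bsub>P.A\<^esub> lam_inv V \<in> Hom P.A (M.LO V) (M.LO V)" by (rule P.A_comp[OF j i])
  show "Id P.A (M.LO V) \<in> Hom P.A (M.LO V) (M.LO V)" by (rule P.A_id[OF M_LO_ob[OF V]])
  have "M.adjunct V (M.LO V) (lam V \<cdot>\<^bsub>P.A\<^esub> lam_inv V) = D.adjunct (\<Lambda> V) (M.LO V) (lam V)"
    by (simp add: M.adjunct_comp[unfolded M.catA_eq, OF V j i] adjunct_lam_inv[OF V] D.adjunct_def
        M.Comp_eq D.Comp_eq M.RA_eq D.RA_eq)
  also have "\<dots> = M.adjunct V (M.LO V) (Id P.A (M.LO V))"
    using M.adjunct_id[OF V] by (simp add: adjunct_lam[OF V] M.catA_eq)
  finally show "M.adjunct V (M.LO V) (lam V \<cdot>\<^bsub>P.A\<^esub> lam_inv V) =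
    M.adjunct V (M.LO V) (Id P.A (M.LO V))" .
qed

lemma lam_inv_lam:
  assumes V: "V \<in> Ob M.B"
  shows "lam_inv V \<cdot>\<^bsub>P.A\<^esub> lam V = Id P.A (D.LO (\<Lambda> V))"
proof (rule D.adjunct_inject[unfolded D.catA_eq, OF \<Lambda>_ob[OF V]])
  note i = lam_hom[OF V] and j = lam_inv_hom[OF V]
  show "lam_inv V \<cdot>\<^bsub>P.A\<^esub> lam V \<in> Hom P.A (D.LO (\<Lambda> V)) (D.LO (\<Lambda> V))" by (rule P.A_comp[OF i j])
  show "Id P.A (D.LO (\<Lambda> V)) \<in> Hom P.A (D.LO (\<Lambda> V)) (D.LO (\<Lambda> V))" by (rule P.A_id[OF D_LO_ob[OF V]])
  have "D.adjunct (\<Lambda> V) (D.LO (\<Lambda> V)) (lam_inv V \<cdot>\<^bsub>P.A\<^esub> lam V) =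
      M.adjunct V (D.LO (\<Lambda> V)) (lam_inv V)"
    by (simp add: D.adjunct_comp[unfolded D.catA_eq, OF \<Lambda>_ob[OF V] i j] adjunct_lam[OF V]
        M.adjunct_def M.Comp_eq D.Comp_eq M.RA_eq D.RA_eq)
  also have "\<dots> = D.adjunct (\<Lambda> V) (D.LO (\<Lambda> V)) (Id P.A (D.LO (\<Lambda> V)))"
    using D.adjunct_id[OF \<Lambda>_ob[OF V]] by (simp add: adjunct_lam_inv[OF V] D.catA_eq)
  finally show "D.adjunct (\<Lambda> V) (D.LO (\<Lambda> V)) (lam_inv V \<cdot>\<^bsub>P.A\<^esub> lam V) =
    D.adjunct (\<Lambda> V) (D.LO (\<Lambda> V)) (Id P.A (D.LO (\<Lambda> V)))" .
qed

lemma lam_nat: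
  assumes f: "f \<in> Hom M.B V W"
  shows "lam W \<cdot>\<^bsub>P.A\<^esub> D.LA (\<Lambda> V) (\<Lambda> W) f = M.LA V W f \<cdot>\<^bsub>P.A\<^esub> lam V"
proof -
  note V = M.B_dom[OF f] and W = M.B_cod[OF f]
  note i = lam_hom[OF V] and j = lam_hom[OF W]
  have g: "f \<in> Hom D.B (\<Lambda> V) (\<Lambda> W)" using f \<Lambda>_Hom[OF V W] by simp
  note Dg = D.LA_hom[OF g, unfolded D.catA_eq] and Mf = M.LA_hom[OF f, unfolded M.catA_eq]
  show ?thesis
  proof (rule D.adjunct_inject[unfolded D.catA_eq, OF \<Lambda>_ob[OF V] P.A_comp[OF Dg j] P.A_comp[OF i Mf]])
    have "D.adjunct (\<Lambda> V) (M.LO W) (lam W \<cdot>\<^bsub>P.A\<^esub> D.LA (\<Lambda> V) (\<Lambda> W) f) = M.\<eta> W \<cdot>\<^bsub>P.B\<^esub> f"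
      by (simp add: D.adjunct_comp_LA[OF g, unfolded D.catA_eq, OF j] adjunct_lam[OF W] D.Comp_eq)
    also have "\<dots> = P.RA (M.LO V) (M.LO W) (M.LA V W f) \<cdot>\<^bsub>P.B\<^esub> M.\<eta> V"
      using M.unt_nat[OF f] by (simp add: M.Comp_eq M.RA_eq)
    also have "\<dots> = D.adjunct (\<Lambda> V) (M.LO W) (M.LA V W f \<cdot>\<^bsub>P.A\<^esub> lam V)"
      by (simp add: D.adjunct_comp[OF \<Lambda>_ob[OF V], unfolded D.catA_eq, OF i Mf] adjunct_lam[OF V]
          D.Comp_eq D.RA_eq)
    finally show "D.adjunct (\<Lambda> V) (M.LO W) (lam W \<cdot>\<^bsub>P.A\<^esub> D.LA (\<Lambda> V) (\<Lambda> W) f) =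
      D.adjunct (\<Lambda> V) (M.LO W) (M.LA V W f \<cdot>\<^bsub>P.A\<^esub> lam V)" .
  qed
qed

text \<open>This is what carries \<open>\<Lambda>\<^sub>n R\<^sub>n = R\<^sub>[\<^sub>n\<^sub>]\<close> on to the next stage, where the actions of the two sides
  are \<open>R\<close> applied to the two sides of the equation.\<close>

lemma counit_lam:
  assumes a: "a \<in> Ob P.A"
  shows "M.\<epsilon> a \<cdot>\<^bsub>P.A\<^esub> lam (M.RO a) = D.\<epsilon> a"
proof -
  note Ra = M.RO_ob[unfolded M.catA_eq, OF a]
  note D = D.RO_ob[unfolded D.catA_eq, OF a]
  note i = lam_hom[OF Ra, unfolded \<Lambda>_RO[OF a]] and e = M.counit_hom[unfolded M.catA_eq, OF a]
  show ?thesis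
  proof (rule D.adjunct_inject[unfolded D.catA_eq, OF D P.A_comp[OF i e]
          D.counit_hom[unfolded D.catA_eq, OF a]])
    have "D.adjunct (D.RO a) a (M.\<epsilon> a \<cdot>\<^bsub>P.A\<^esub> lam (M.RO a)) =
        P.RA (M.LO (M.RO a)) a (M.\<epsilon> a) \<cdot>\<^bsub>P.B\<^esub> M.\<eta> (M.RO a)"
      using adjunct_lam[OF Ra]
      by (simp add: D.adjunct_comp[OF D, unfolded D.catA_eq, OF i e] \<Lambda>_RO[OF a] D.Comp_eq D.RA_eq)
    also have "\<dots> = D.adjunct (D.RO a) a (D.\<epsilon> a)"
      using M.RA_counit_unt[unfolded M.catA_eq, OF a] D.adjunct_counit[unfolded D.catA_eq, OF a]
      by (simp add: M.Comp_eq M.RA_eq M.Id_eq M.U_RO D.Id_eq D.U_RO)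
    finally show "D.adjunct (D.RO a) a (M.\<epsilon> a \<cdot>\<^bsub>P.A\<^esub> lam (M.RO a)) = D.adjunct (D.RO a) a (D.\<epsilon> a)" .
  qed
qed

lemma
  assumes V: "V \<in> Ob M.B"
  shows R_lam_hom: "P.RA (D.LO (\<Lambda> V)) (M.LO V) (lam V) \<in> Hom P.B (P.RO (D.LO (\<Lambda> V))) (P.RO (M.LO V))"
    and R_lam_inv_hom:
      "P.RA (M.LO V) (D.LO (\<Lambda> V)) (lam_inv V) \<in> Hom P.B (P.RO (M.LO V)) (P.RO (D.LO (\<Lambda> V)))"
    and R_lam_lam_inv: "P.RA (D.LO (\<Lambda> V)) (M.LO V) (lam V) \<cdot>\<^bsub>P.B\<^esub>
      P.RA (M.LO V) (D.LO (\<Lambda> V)) (lam_inv V) = Id P.B (P.RO (M.LO V))"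
    and R_lam_inv_lam: "P.RA (M.LO V) (D.LO (\<Lambda> V)) (lam_inv V) \<cdot>\<^bsub>P.B\<^esub>
      P.RA (D.LO (\<Lambda> V)) (M.LO V) (lam V) = Id P.B (P.RO (D.LO (\<Lambda> V)))"
  using P.RA_hom[OF lam_hom[OF V]] P.RA_hom[OF lam_inv_hom[OF V]]
    P.RA_comp[OF lam_hom[OF V] lam_inv_hom[OF V]] P.RA_comp[OF lam_inv_hom[OF V] lam_hom[OF V]]
  by (simp_all add: lam_lam_inv[OF V] lam_inv_lam[OF V] P.RA_id M_LO_ob[OF V] D_LO_ob[OF V])

lemma R_lam_unt:
  assumes V: "V \<in> Ob M.B"
  shows "P.RA (D.LO (\<Lambda> V)) (M.LO V) (lam V) \<cdot>\<^bsub>P.B\<^esub> D.\<eta> (\<Lambda> V) = M.\<eta> V"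
  using adjunct_lam[OF V] by (simp add: D.adjunct_def D.Comp_eq D.RA_eq)

text \<open>The object part of \<open>\<Lambda>\<^sub>n\<^sub>+\<^sub>1\<close>.\<close>

definition \<Lambda>' :: "('ob, 'mb) tob \<Rightarrow> ('ob, 'mb) tob" where
  "\<Lambda>' X = Ext (\<Lambda> (lower X))
     (action X \<cdot>\<^bsub>P.B\<^esub> P.RA (D.LO (\<Lambda> (lower X))) (M.LO (lower X)) (lam (lower X)))"

lemma EM_action:
  assumes "X \<in> Ob (adj_EM M)"
  shows "lower X \<in> Ob M.B"
    and "action X \<in> Hom P.B (P.RO (M.LO (lower X))) (FO (forget n) (lower X))"
  using assms M.U_hom[of "action X" "M.RO (M.LO (lower X))" "lower X"]
  by (auto simp: EM_Ob_iff M.U_RO)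

lemma \<Lambda>'_ob:
  assumes X: "X \<in> Ob (adj_EM M)"
  shows "\<Lambda>' X \<in> dec_Ob P n D"
  using EM_action[OF X] \<Lambda>_ob P.B_comp[OF R_lam_hom EM_action(2)[OF X]]
  by (simp add: dec_Ob_iff \<Lambda>'_def U_\<Lambda>)

lemma \<Lambda>'_RO:
  assumes a: "a \<in> Ob P.A"
  shows "\<Lambda>' (FO (comparison M) a) = FO (dec_R P D) a"
proof -
  note Ra = M.RO_ob[unfolded M.catA_eq, OF a]
  show ?thesis
    using P.RA_comp[OF lam_hom[OF Ra] M.counit_hom[unfolded M.catA_eq, OF a]]
    by (simp add: \<Lambda>'_def comparison_def dec_R_def comp_ftor_def \<Lambda>_RO[OF a] counit_lam[OF a]
        M.RA_eq)
qed

text \<open>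
  Naturality of \<open>\<lambda>\<close>, in the form in which it compares the condition on arrows between
  \<open>\<Lambda>\<^sub>n\<^sub>+\<^sub>1 X\<close> and \<open>\<Lambda>\<^sub>n\<^sub>+\<^sub>1 Y\<close> with that on arrows between the algebras \<open>X\<close> and \<open>Y\<close>.
\<close>

lemma R_lam_nat:
  assumes f: "f \<in> Hom M.B V W" and Y: "b \<in> Hom P.B (P.RO (M.LO W)) Y"
  shows "(b \<cdot>\<^bsub>P.B\<^esub> P.RA (D.LO (\<Lambda> W)) (M.LO W) (lam W)) \<cdot>\<^bsub>P.B\<^esub>
      P.RA (D.LO (\<Lambda> V)) (D.LO (\<Lambda> W)) (D.LA (\<Lambda> V) (\<Lambda> W) f) =
    (b \<cdot>\<^bsub>P.B\<^esub> P.RA (M.LO V) (M.LO W) (M.LA V W f)) \<cdot>\<^bsub>P.B\<^esub> P.RA (D.LO (\<Lambda> V)) (M.LO V) (lam V)"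
proof -
  note V = M.B_dom[OF f] and W = M.B_cod[OF f]
  note i = lam_hom[OF V] and j = lam_hom[OF W]
  have g: "f \<in> Hom D.B (\<Lambda> V) (\<Lambda> W)" using f \<Lambda>_Hom[OF V W] by simp
  note Dg = D.LA_hom[OF g, unfolded D.catA_eq] and Mf = M.LA_hom[OF f, unfolded M.catA_eq]
  show ?thesis
    using P.RA_comp[OF Dg j] P.RA_comp[OF i Mf]
    by (simp add: lam_nat[OF f] P.B_assoc[OF P.RA_hom[OF Dg] P.RA_hom[OF j] Y]
        P.B_assoc[OF P.RA_hom[OF i] P.RA_hom[OF Mf] Y])
qed

lemma R_lam_epi:
  assumes V: "V \<in> Ob M.B"
    and g: "g \<in> Hom P.B (P.RO (M.LO V)) Y" and h: "h \<in> Hom P.B (P.RO (M.LO V)) Y"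
    and eq: "g \<cdot>\<^bsub>P.B\<^esub> P.RA (D.LO (\<Lambda> V)) (M.LO V) (lam V) =
      h \<cdot>\<^bsub>P.B\<^esub> P.RA (D.LO (\<Lambda> V)) (M.LO V) (lam V)"
  shows "g = h"
  using eq P.B_assoc[OF R_lam_inv_hom[OF V] R_lam_hom[OF V] g]
    P.B_assoc[OF R_lam_inv_hom[OF V] R_lam_hom[OF V] h] R_lam_lam_inv[OF V]
    P.B_comp_id[OF g] P.B_comp_id[OF h]
  by metis

text \<open>
  By naturality of \<open>\<lambda>\<close> the condition for \<open>f\<close> to be an arrow between the images is the condition for it
  to be an arrow between the algebras, precomposed with the isomorphism \<open>R \<lambda>\<close>.
\<close>

lemma \<Lambda>'_Hom:
  assumes X: "X \<in> Ob (adj_EM M)" and Y: "Y \<in> Ob (adj_EM M)"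
  shows "Hom (dec_cat P n D) (\<Lambda>' X) (\<Lambda>' Y) = Hom (adj_EM M) X Y"
proof (rule set_eqI)
  fix f
  note aX = EM_action[OF X] and aY = EM_action[OF Y]
  let ?T = "P.RA (M.LO (lower X)) (M.LO (lower Y)) (M.LA (lower X) (lower Y) f)"
  let ?i = "P.RA (D.LO (\<Lambda> (lower X))) (M.LO (lower X)) (lam (lower X))"
  have "f \<cdot>\<^bsub>P.B\<^esub> action (\<Lambda>' X) = action (\<Lambda>' Y) \<cdot>\<^bsub>P.B\<^esub>
       P.RA (D.LO (\<Lambda> (lower X))) (D.LO (\<Lambda> (lower Y))) (D.LA (\<Lambda> (lower X)) (\<Lambda> (lower Y)) f)
     \<longleftrightarrow> f \<cdot>\<^bsub>P.B\<^esub> action X = action Y \<cdot>\<^bsub>P.B\<^esub> ?T" (is "?l \<longleftrightarrow> ?r")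
    if f: "f \<in> Hom M.B (lower X) (lower Y)"
  proof -
    have "?l \<longleftrightarrow> (f \<cdot>\<^bsub>P.B\<^esub> action X) \<cdot>\<^bsub>P.B\<^esub> ?i = (action Y \<cdot>\<^bsub>P.B\<^esub> ?T) \<cdot>\<^bsub>P.B\<^esub> ?i"
      by (simp add: \<Lambda>'_def R_lam_nat[OF f aY(2)] P.B_assoc[OF R_lam_hom[OF aX(1)] aX(2) M.U_hom[OF f]])
    also have "\<dots> \<longleftrightarrow> ?r"
      using R_lam_epi[OF aX(1) P.B_comp[OF aX(2) M.U_hom[OF f]]
          P.B_comp[OF P.RA_hom[OF M.LA_hom[OF f, unfolded M.catA_eq]] aY(2)]]
      by metis
    finally show ?thesis .
  qed
  then show "f \<in> Hom (dec_cat P n D) (\<Lambda>' X) (\<Lambda>' Y) \<longleftrightarrow> f \<in> Hom (adj_EM M) X Y"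
    using X Y \<Lambda>'_ob \<Lambda>_Hom[OF aX(1) aY(1)]
    unfolding EM_hom_iff dec_hom_iff
    by (auto simp: M.Comp_eq M.RA_eq \<Lambda>'_def)
qed

text \<open>
  The action of \<open>\<Lambda>\<^sub>n\<^sub>+\<^sub>1 X\<close> retracts \<open>\<eta>\<^sub>[\<^sub>n\<^sub>]\<close>: as \<open>R \<lambda>\<close> takes \<open>\<eta>\<^sub>[\<^sub>n\<^sub>]\<close> to \<open>\<eta>\<^sub>n\<close>, the composite is the unit
  law of the algebra \<open>X\<close>. The retraction lives in \<open>B\<close> only, whence the class \<open>M(U\<^sub>[\<^sub>n\<^sub>])\<close>.
\<close>

lemma mono_unt_of_image:
  assumes X: "X \<in> Ob (adj_EM M)"
  shows "D.\<eta> (\<Lambda> (lower X)) \<in>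
    mono_class D.B P.B (forget n) (\<Lambda> (lower X)) (D.RO (D.LO (\<Lambda> (lower X))))"
proof -
  note aX = EM_action[OF X]
  note V = aX(1)
  note u = D.unt_hom[OF \<Lambda>_ob[OF V]]
  note i = R_lam_hom[OF V]
  have e: "D.\<eta> (\<Lambda> (lower X)) \<in> Hom P.B (FO (forget n) (lower X)) (P.RO (D.LO (\<Lambda> (lower X))))"
    using D.U_hom[OF u] by (simp add: U_\<Lambda> D.U_RO)
  have "action (\<Lambda>' X) \<cdot>\<^bsub>P.B\<^esub> D.\<eta> (\<Lambda> (lower X)) = action X \<cdot>\<^bsub>P.B\<^esub> M.\<eta> (lower X)"
    by (simp add: \<Lambda>'_def P.B_assoc[OF e i aX(2)] R_lam_unt[OF V])
  also have "\<dots> = Id P.B (FO (forget n) (lower X))"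
    using X by (auto simp: EM_Ob_iff M.Comp_eq M.Id_eq)
  finally have r: "action (\<Lambda>' X) \<cdot>\<^bsub>P.B\<^esub> D.\<eta> (\<Lambda> (lower X)) = Id P.B (FO (forget n) (lower X))" .
  have "action (\<Lambda>' X) \<in> Hom P.B (P.RO (D.LO (\<Lambda> (lower X)))) (FO (forget n) (lower X))"
    using P.B_comp[OF i aX(2)] by (simp add: \<Lambda>'_def)
  from split_monomorphism[OF P.catB e this r] u show ?thesis
    by (simp add: mono_class_def U_\<Lambda> D.U_RO)
qed

end

section \<open>Descent along monomorphisms\<close>

lemma (in stage) monomorphism_reflect:
  assumes g: "g \<in> Hom B X Y" and mono: "monomorphism P.B (FO (forget n) X) (FO (forget n) Y) g"
  shows "monomorphism B X Y g"
  using g mono U_hom unfolding monomorphism_def Comp_eq by blast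

context
  fixes S :: "('oa, 'ma, ('ob, 'mb) tob, 'mb) adj"
  assumes S: "adjunction S"
begin

interpretation adjoint S
  by standard (rule S)

text \<open>
  Composed with \<open>g\<close>, each law for \<open>\<mu>\<close> becomes the same law for \<open>c\<close> applied to \<open>g\<close>, by naturality of the
  unit and the multiplication \<open>m = R \<epsilon> L\<close>; the monomorphism \<open>g\<close> then cancels.
\<close>

lemma subalgebra:
  assumes Y: "Ext W c \<in> Ob (adj_EM S)" and g: "monomorphism B V W g"
    and \<mu>: "\<mu> \<in> Hom B (RO (LO V)) V"
    and eq: "g \<cdot>\<^bsub>B\<^esub> \<mu> = c \<cdot>\<^bsub>B\<^esub> RA (LO V) (LO W) (LA V W g)"
  shows "Ext V \<mu> \<in> Ob (adj_EM S)"
proof -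
  have g': "g \<in> Hom B V W" using g by (simp add: monomorphism_def)
  define T where "T X Y f = RA (LO X) (LO Y) (LA X Y f)" for X Y f
  have T: "T X Y f \<in> Hom B (RO (LO X)) (RO (LO Y))" if "f \<in> Hom B X Y" for X Y f
    unfolding T_def by (rule RA_hom[OF LA_hom[OF that]])
  have T_comp: "T X Z (k \<cdot>\<^bsub>B\<^esub> f) = T Y Z k \<cdot>\<^bsub>B\<^esub> T X Y f"
    if "f \<in> Hom B X Y" "k \<in> Hom B Y Z" for X Y Z f k
    unfolding T_def by (simp add: LA_comp[OF that] RA_comp[OF that[THEN LA_hom]])
  define m where "m X = RA (LO (RO (LO X))) (LO X) (\<epsilon> (LO X))" for X
  have m: "m X \<in> Hom B (RO (LO (RO (LO X)))) (RO (LO X))" if "X \<in> Ob B" for X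
    unfolding m_def by (rule RA_hom[OF counit_hom[OF LO_ob[OF that]]])
  have m_nat: "m Y \<cdot>\<^bsub>B\<^esub> T (RO (LO X)) (RO (LO Y)) (T X Y f) = T X Y f \<cdot>\<^bsub>B\<^esub> m X"
    if f: "f \<in> Hom B X Y" for X Y f
  proof -
    note Lf = LA_hom[OF f]
    show ?thesis
      using counit_nat[OF Lf] RA_comp[OF counit_hom[OF A_dom[OF Lf]] Lf]
        RA_comp[OF LA_hom[OF RA_hom[OF Lf]] counit_hom[OF A_cod[OF Lf]]]
      by (simp add: T_def m_def)
  qed
  note V = B_dom[OF g'] and W = B_cod[OF g']
  have c: "c \<in> Hom B (RO (LO W)) W" and c_unit: "c \<cdot>\<^bsub>B\<^esub> \<eta> W = Id B W"
    and c_assoc: "c \<cdot>\<^bsub>B\<^esub> T (RO (LO W)) W c = c \<cdot>\<^bsub>B\<^esub> m W"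
    using Y by (auto simp: EM_Ob_iff T_def m_def)
  have eq: "g \<cdot>\<^bsub>B\<^esub> \<mu> = c \<cdot>\<^bsub>B\<^esub> T V W g" using eq by (simp add: T_def)
  have T\<mu>: "T (RO (LO V)) V \<mu> \<in> Hom B (RO (LO (RO (LO V)))) (RO (LO V))" by (rule T[OF \<mu>])
  note Tg = T[OF g'] and Tc = T[OF c] and \<eta>V = unt_hom[OF V] and \<eta>W = unt_hom[OF W]
  have "\<mu> \<cdot>\<^bsub>B\<^esub> \<eta> V = Id B V"
  proof (rule monomorphism_cancel[OF g _ B_comp[OF \<eta>V \<mu>] B_id[OF V]])
    have "g \<cdot>\<^bsub>B\<^esub> (\<mu> \<cdot>\<^bsub>B\<^esub> \<eta> V) = c \<cdot>\<^bsub>B\<^esub> (T V W g \<cdot>\<^bsub>B\<^esub> \<eta> V)"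
      by (simp add: B_assoc[OF \<eta>V \<mu> g', symmetric] eq B_assoc[OF \<eta>V Tg c])
    also have "\<dots> = (c \<cdot>\<^bsub>B\<^esub> \<eta> W) \<cdot>\<^bsub>B\<^esub> g"
      using unt_nat[OF g'] by (simp add: T_def B_assoc[OF g' \<eta>W c])
    finally show "g \<cdot>\<^bsub>B\<^esub> (\<mu> \<cdot>\<^bsub>B\<^esub> \<eta> V) = g \<cdot>\<^bsub>B\<^esub> Id B V"
      by (simp add: c_unit B_id_comp[OF g'] B_comp_id[OF g'])
  qed
  moreover have "\<mu> \<cdot>\<^bsub>B\<^esub> T (RO (LO V)) V \<mu> = \<mu> \<cdot>\<^bsub>B\<^esub> m V"
  proof (rule monomorphism_cancel[OF g _ B_comp[OF T\<mu> \<mu>] B_comp[OF m[OF V] \<mu>]])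
    have "g \<cdot>\<^bsub>B\<^esub> (\<mu> \<cdot>\<^bsub>B\<^esub> T (RO (LO V)) V \<mu>) = c \<cdot>\<^bsub>B\<^esub> (T V W g \<cdot>\<^bsub>B\<^esub> T (RO (LO V)) V \<mu>)"
      by (simp add: B_assoc[OF T\<mu> \<mu> g', symmetric] eq B_assoc[OF T\<mu> Tg c])
    also have "\<dots> = c \<cdot>\<^bsub>B\<^esub> (T (RO (LO W)) W c \<cdot>\<^bsub>B\<^esub> T (RO (LO V)) (RO (LO W)) (T V W g))"
      using T_comp[OF \<mu> g'] T_comp[OF Tg c] by (simp add: eq)
    also have "\<dots> = c \<cdot>\<^bsub>B\<^esub> (m W \<cdot>\<^bsub>B\<^esub> T (RO (LO V)) (RO (LO W)) (T V W g))"
      by (simp add: B_assoc[OF T[OF Tg] Tc c, symmetric] c_assoc B_assoc[OF T[OF Tg] m[OF W] c])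
    also have "\<dots> = (c \<cdot>\<^bsub>B\<^esub> T V W g) \<cdot>\<^bsub>B\<^esub> m V"
      by (simp add: m_nat[OF g'] B_assoc[OF m[OF V] Tg c])
    also have "\<dots> = g \<cdot>\<^bsub>B\<^esub> (\<mu> \<cdot>\<^bsub>B\<^esub> m V)"
      by (simp add: eq[symmetric] B_assoc[OF m[OF V] \<mu> g'])
    finally show "g \<cdot>\<^bsub>B\<^esub> (\<mu> \<cdot>\<^bsub>B\<^esub> T (RO (LO V)) V \<mu>) = g \<cdot>\<^bsub>B\<^esub> (\<mu> \<cdot>\<^bsub>B\<^esub> m V)" .
  qed
  ultimately show ?thesis using V \<mu> by (simp add: EM_Ob_iff T_def m_def)
qed

text \<open>
  Both \<open>g\<close> and \<open>g \<circ> \<beta>\<close> commute with the actions, so the two sides of the condition on \<open>\<beta>\<close> agree after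
  composition with \<open>g\<close>.
\<close>

lemma reflect_EM_hom:
  assumes gh: "g \<in> Hom (adj_EM S) V C" and mono: "monomorphism B (lower V) (lower C) g"
    and W: "W \<in> Ob (adj_EM S)" and \<beta>: "\<beta> \<in> Hom B (lower W) (lower V)"
    and h: "g \<cdot>\<^bsub>B\<^esub> \<beta> \<in> Hom (adj_EM S) W C"
  shows "\<beta> \<in> Hom (adj_EM S) W V"
proof -
  define T where "T X Y f = RA (LO X) (LO Y) (LA X Y f)" for X Y f
  have T: "T X Y f \<in> Hom B (RO (LO X)) (RO (LO Y))" if "f \<in> Hom B X Y" for X Y f
    unfolding T_def by (rule RA_hom[OF LA_hom[OF that]])
  have g: "g \<in> Hom B (lower V) (lower C)" and V: "V \<in> Ob (adj_EM S)" and C: "C \<in> Ob (adj_EM S)"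
    and gv: "g \<cdot>\<^bsub>B\<^esub> action V = action C \<cdot>\<^bsub>B\<^esub> T (lower V) (lower C) g"
    using gh by (auto simp: EM_hom_iff T_def)
  have act: "action X \<in> Hom B (RO (LO (lower X))) (lower X)" if "X \<in> Ob (adj_EM S)" for X
    using that by (auto simp: EM_Ob_iff)
  have hw: "(g \<cdot>\<^bsub>B\<^esub> \<beta>) \<cdot>\<^bsub>B\<^esub> action W = action C \<cdot>\<^bsub>B\<^esub> T (lower W) (lower C) (g \<cdot>\<^bsub>B\<^esub> \<beta>)"
    using h by (auto simp: EM_hom_iff T_def)
  have Tgb: "T (lower W) (lower C) (g \<cdot>\<^bsub>B\<^esub> \<beta>) =
      T (lower V) (lower C) g \<cdot>\<^bsub>B\<^esub> T (lower W) (lower V) \<beta>"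
    unfolding T_def by (simp add: LA_comp[OF \<beta> g] RA_comp[OF \<beta>[THEN LA_hom] g[THEN LA_hom]])
  have "\<beta> \<cdot>\<^bsub>B\<^esub> action W = action V \<cdot>\<^bsub>B\<^esub> T (lower W) (lower V) \<beta>"
  proof (rule monomorphism_cancel[OF mono _ B_comp[OF act[OF W] \<beta>] B_comp[OF T[OF \<beta>] act[OF V]]])
    have "g \<cdot>\<^bsub>B\<^esub> (\<beta> \<cdot>\<^bsub>B\<^esub> action W) =
        (action C \<cdot>\<^bsub>B\<^esub> T (lower V) (lower C) g) \<cdot>\<^bsub>B\<^esub> T (lower W) (lower V) \<beta>"
      by (simp add: B_assoc[OF act[OF W] \<beta> g, symmetric] hw)
        (simp add: Tgb B_assoc[OF T[OF \<beta>] T[OF g] act[OF C]])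
    also have "\<dots> = g \<cdot>\<^bsub>B\<^esub> (action V \<cdot>\<^bsub>B\<^esub> T (lower W) (lower V) \<beta>)"
      by (simp add: gv[symmetric] B_assoc[OF T[OF \<beta>] act[OF V] g])
    finally show "g \<cdot>\<^bsub>B\<^esub> (\<beta> \<cdot>\<^bsub>B\<^esub> action W) =
      g \<cdot>\<^bsub>B\<^esub> (action V \<cdot>\<^bsub>B\<^esub> T (lower W) (lower V) \<beta>)" .
  qed
  then show ?thesis using V W \<beta> by (simp add: EM_hom_iff T_def)
qed

end

text \<open>
  The inductive step of the first claim. The assumption \<open>reflect\<close> serves to see that
  the transported action \<open>\<mu>\<close>, at first an arrow of \<open>B\<close>, belongs to \<open>B\<^sub>n\<close>.
\<close>

lemma (in tower_comparison) \<Lambda>'_image_of_mono: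
  assumes C: "C \<in> Ob (adj_EM M)" and f: "f \<in> Hom (dec_cat P n D) X (\<Lambda>' C)"
    and mono: "monomorphism P.B (FO (forget n) (lower X)) (FO (forget n) (lower C)) f"
    and V: "V \<in> Ob M.B" and X: "lower X = \<Lambda> V"
    and reflect: "\<And>W \<beta>. \<lbrakk>W \<in> Ob M.B; \<beta> \<in> Hom P.B (FO (forget n) W) (FO (forget n) V);
      f \<cdot>\<^bsub>P.B\<^esub> \<beta> \<in> Hom M.B W (lower C)\<rbrakk> \<Longrightarrow> \<beta> \<in> Hom M.B W V"
  shows "\<exists>Y\<in>Ob (adj_EM M). \<Lambda>' Y = X"
proof -
  obtain b where Xb: "X = Ext (\<Lambda> V) b" and b: "b \<in> Hom P.B (P.RO (D.LO (\<Lambda> V))) (FO (forget n) V)"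
    using f X by (auto simp: dec_hom_iff dec_Ob_iff U_\<Lambda>)
  note aC = EM_action[OF C]
  have fV: "f \<in> Hom M.B V (lower C)"
    using f \<Lambda>_Hom[OF V aC(1)] by (simp add: dec_hom_iff Xb \<Lambda>'_def)
  let ?i = "P.RA (D.LO (\<Lambda> V)) (M.LO V) (lam V)" and ?j = "P.RA (M.LO V) (D.LO (\<Lambda> V)) (lam_inv V)"
  let ?T = "P.RA (M.LO V) (M.LO (lower C)) (M.LA V (lower C) f)"
  note i = R_lam_hom[OF V] and j = R_lam_inv_hom[OF V] and Uf = M.U_hom[OF fV]
  have T: "?T \<in> Hom P.B (P.RO (M.LO V)) (P.RO (M.LO (lower C)))"
    by (rule P.RA_hom[OF M.LA_hom[OF fV, unfolded M.catA_eq]])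
  have fb: "f \<cdot>\<^bsub>P.B\<^esub> b = (action C \<cdot>\<^bsub>P.B\<^esub> ?T) \<cdot>\<^bsub>P.B\<^esub> ?i"
    using f R_lam_nat[OF fV aC(2)] by (simp add: dec_hom_iff Xb \<Lambda>'_def)
  define \<mu> where "\<mu> = b \<cdot>\<^bsub>P.B\<^esub> ?j"
  have \<mu>: "\<mu> \<in> Hom P.B (P.RO (M.LO V)) (FO (forget n) V)"
    unfolding \<mu>_def by (rule P.B_comp[OF j b])
  have b_eq: "b = \<mu> \<cdot>\<^bsub>P.B\<^esub> ?i"
    by (simp add: \<mu>_def P.B_assoc[OF i j b] R_lam_inv_lam[OF V] P.B_comp_id[OF b])
  have f\<mu>: "f \<cdot>\<^bsub>P.B\<^esub> \<mu> = action C \<cdot>\<^bsub>P.B\<^esub> ?T"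
    using P.B_comp[OF T aC(2)]
    by (simp add: \<mu>_def P.B_assoc[OF j b Uf, symmetric] fb P.B_assoc[OF j i P.B_comp[OF T aC(2)]]
        R_lam_lam_inv[OF V] P.B_comp_id)
  have c: "action C \<in> Hom M.B (M.RO (M.LO (lower C))) (lower C)"
    using C by (auto simp: EM_Ob_iff)
  have "f \<cdot>\<^bsub>P.B\<^esub> \<mu> \<in> Hom M.B (M.RO (M.LO V)) (lower C)"
    using M.B_comp[OF M.RA_hom[OF M.LA_hom[OF fV]] c] by (simp add: f\<mu> M.Comp_eq M.RA_eq)
  then have \<mu>V: "\<mu> \<in> Hom M.B (M.RO (M.LO V)) V"
    using reflect[OF M.RO_ob[OF M.LO_ob[OF V]]] \<mu> by (simp add: M.U_RO)
  have "monomorphism M.B V (lower C) f"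
    using M.monomorphism_reflect[OF fV] mono by (simp add: Xb U_\<Lambda>)
  moreover have "Ext (lower C) (action C) \<in> Ob (adj_EM M)"
    using C by (auto simp: EM_Ob_iff)
  ultimately have "Ext V \<mu> \<in> Ob (adj_EM M)"
    using subalgebra[OF M.adjunction] \<mu>V f\<mu> by (simp add: M.Comp_eq M.RA_eq)
  moreover have "\<Lambda>' (Ext V \<mu>) = X"
    by (simp add: \<Lambda>'_def Xb b_eq)
  ultimately show ?thesis by blast
qed

section \<open>The image of the comparison functors\<close>

lemma FA_Lam [simp]: "FA (Lam P cq n) X Y f = f"
  by (induction n arbitrary: X Y) (simp_all add: id_ftor_def Let_def)

lemma FO_forget_Lam: "FO (forget n) (FO (Lam P cq n) X) = FO (forget n) X"
  by (induction n arbitrary: X) (simp_all add: id_ftor_def Let_def)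

context
  fixes P :: "('oa, 'ma, 'ob, 'mb) adj" and cq :: "('oa, 'ma) coeq_choice"
  assumes P: "adjunction P" and cq: "chosen_coequalizers (catA P) cq"
begin

lemma catB_mon_Suc: "catB (mon_adj P cq (Suc n)) = adj_EM (mon_adj P cq n)"
  and radj_mon_Suc: "radj (mon_adj P cq (Suc n)) = comparison (mon_adj P cq n)"
  by (simp_all add: Let_def lift_adj_def)

lemma catB_dec_Suc: "catB (dec_adj P cq (Suc n)) = dec_cat P n (dec_adj P cq n)"
  and radj_dec_Suc: "radj (dec_adj P cq (Suc n)) = dec_R P (dec_adj P cq n)"
  by (simp_all add: Let_def dec_adj_def lift_adj_def split: prod.split)

lemma FO_Lam_Suc:
  assumes "tower_comparison P n (mon_adj P cq n) (dec_adj P cq n) (FO (Lam P cq n))"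
  shows "FO (Lam P cq (Suc n)) X =
    tower_comparison.\<Lambda>' P (mon_adj P cq n) (dec_adj P cq n) (FO (Lam P cq n)) X"
proof -
  interpret tower_comparison P n "mon_adj P cq n" "dec_adj P cq n" "FO (Lam P cq n)" by fact
  show ?thesis
    by (simp add: Let_def \<Lambda>'_def lam_def lambda_iso_def comp_ftor_def D.catA_eq)
qed

lemma tower_comparison_Lam:
  "tower_comparison P n (mon_adj P cq n) (dec_adj P cq n) (FO (Lam P cq n))"
proof (induction n)
  case 0
  interpret stage P 0 "base_adj P" by (rule stage_0[OF P])
  have "tower_comparison P 0 (base_adj P) (base_adj P) (\<lambda>X. X)"
    by unfold_locales simp_all
  then show ?case by (simp add: dec_adj_def id_ftor_def)
next
  case (Suc n)
  let ?M = "mon_adj P cq n" and ?D = "dec_adj P cq n" and ?L = "FO (Lam P cq n)"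
  interpret tower_comparison P n ?M ?D ?L by fact
  interpret M': stage P "Suc n" "mon_adj P cq (Suc n)" by (rule stage_mon_adj[OF P cq])
  interpret D': dec_stage P "Suc n" "dec_adj P cq (Suc n)" "snd (decomp P cq (Suc n))"
    by (rule dec_stage_decomp[OF P cq])
  have Ob_dec: "Ob (dec_cat P n ?D) = dec_Ob P n ?D" by (simp add: dec_cat_def)
  show ?case
  proof unfold_locales
    show "FO (forget (Suc n)) (FO (Lam P cq (Suc n)) X) = FO (forget (Suc n)) X" for X
      by (rule FO_forget_Lam)
  qed (simp_all only: FO_Lam_Suc[OF Suc] catB_mon_Suc catB_dec_Suc radj_mon_Suc radj_dec_Suc
      Ob_dec \<Lambda>'_ob \<Lambda>'_RO \<Lambda>'_Hom)
qed

text \<open>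
  An arrow of \<open>B\<close> lies in \<open>B\<^sub>n\<close> as soon as it does so after composition with an arrow of \<open>B\<^sub>n\<close> that
  is mono in \<open>B\<close>: the actions at the stages below \<open>n\<close> are tested one after the other.
\<close>

lemma mon_hom_reflect:
  assumes "g \<in> Hom (catB (mon_adj P cq n)) V C"
    and "monomorphism (catB P) (FO (forget n) V) (FO (forget n) C) g"
    and "W \<in> Ob (catB (mon_adj P cq n))"
    and "\<beta> \<in> Hom (catB P) (FO (forget n) W) (FO (forget n) V)"
    and "g \<cdot>\<^bsub>catB P\<^esub> \<beta> \<in> Hom (catB (mon_adj P cq n)) W C"
  shows "\<beta> \<in> Hom (catB (mon_adj P cq n)) W V"
  using assms
proof (induction n arbitrary: V W C)
  case 0
  then show ?case by (auto simp: base_adj_def base_cat_def)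
next
  case (Suc n)
  interpret stage P n "mon_adj P cq n" by (rule stage_mon_adj[OF P cq])
  note prems = Suc.prems[unfolded catB_mon_Suc FO_forget_Suc]
  have g: "g \<in> Hom B (lower V) (lower C)" and h: "g \<cdot>\<^bsub>P.B\<^esub> \<beta> \<in> Hom B (lower W) (lower C)"
    and W: "lower W \<in> Ob B"
    using prems by (auto simp: EM_hom_iff EM_Ob_iff)
  have "\<beta> \<in> Hom B (lower W) (lower V)"
    using Suc.IH[OF g prems(2) W prems(4) h] .
  with reflect_EM_hom[OF adjunction prems(1) monomorphism_reflect[OF g prems(2)] prems(3)] prems(5)
  show ?case by (simp only: catB_mon_Suc Comp_eq)
qed

lemma Lam_image_of_mono:
  assumes "C \<in> Ob (catB (mon_adj P cq n))"
    and "f \<in> mono_class (catB (dec_adj P cq n)) (catB P) (forget n) X (FO (Lam P cq n) C)"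
  shows "X \<in> Im_ftor (catB (mon_adj P cq n)) (Lam P cq n)"
  using assms
proof (induction n arbitrary: X C)
  case 0
  then show ?case
    by (auto simp: Im_ftor_def mono_class_def id_ftor_def dec_adj_def base_adj_def base_cat_def)
next
  case (Suc n)
  let ?M = "mon_adj P cq n" and ?D = "dec_adj P cq n" and ?L = "FO (Lam P cq n)"
  interpret tower_comparison P n ?M ?D ?L by (rule tower_comparison_Lam)
  note FO_L = FO_Lam_Suc[OF tower_comparison_axioms]
  have C: "C \<in> Ob (adj_EM ?M)" using Suc.prems(1) by (simp only: catB_mon_Suc)
  have f: "f \<in> Hom (dec_cat P n ?D) X (\<Lambda>' C)"
    and mono: "monomorphism P.B (FO (forget n) (lower X)) (FO (forget n) (lower C)) f"
    using Suc.prems(2)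
    by (auto simp: mono_class_def catB_dec_Suc FO_L \<Lambda>'_def U_\<Lambda> simp del: Lam.simps)
  note lC = EM_action(1)[OF C]
  have f0: "f \<in> Hom D.B (lower X) (?L (lower C))"
    using f by (simp add: dec_hom_iff \<Lambda>'_def)
  then have "f \<in> mono_class D.B P.B (forget n) (lower X) (?L (lower C))"
    using mono by (simp add: mono_class_def U_\<Lambda>)
  from Suc.IH[OF lC this] obtain V where V: "V \<in> Ob M.B" and X: "lower X = ?L V"
    by (auto simp: Im_ftor_def)
  have "f \<in> Hom M.B V (lower C)"
    using f0 \<Lambda>_Hom[OF V lC] by (simp add: X)
  moreover have "monomorphism P.B (FO (forget n) V) (FO (forget n) (lower C)) f"
    using mono by (simp add: X U_\<Lambda>)
  ultimately obtain Y where "Y \<in> Ob (adj_EM ?M)" "\<Lambda>' Y = X"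
    using \<Lambda>'_image_of_mono[OF C f mono V X] mon_hom_reflect by blast
  then show ?case
    unfolding Im_ftor_def catB_mon_Suc FO_L by blast
qed

end

theorem theorem4p20:
  fixes P :: "('oa, 'ma, 'ob, 'mb) adj"
    and cq :: "('oa, 'ma) coeq_choice"
    and n :: nat
  assumes "adjunction P"
    and "chosen_coequalizers (catA P) cq"
  shows
    "(\<forall>X C f. C \<in> Ob (catB (mon_adj P cq n)) \<longrightarrow>
        f \<in> mono_class (catB (dec_adj P cq n)) (catB P) (forget n) X (FO (Lam P cq n) C) \<longrightarrow>
        X \<in> Im_ftor (catB (mon_adj P cq n)) (Lam P cq n))
     \<and>
     (\<forall>X \<in> Ob (catB (dec_adj P cq n)).
        unt (dec_adj P cq n) X
          \<in> mono_class (catB (dec_adj P cq n)) (catB P) (forget n)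
              X (FO (radj (dec_adj P cq n) \<circ>\<^sub>F ladj (dec_adj P cq n)) X) \<longrightarrow>
        X \<in> Im_ftor (catB (mon_adj P cq n)) (Lam P cq n))
     \<and>
     (\<forall>X b. Ext X b \<in> Ob (catB (dec_adj P cq (Suc n))) \<longrightarrow>
        Ext X b \<in> Im_ftor (catB (mon_adj P cq (Suc n))) (Lam P cq (Suc n)) \<longrightarrow>
        unt (dec_adj P cq n) X
          \<in> mono_class (catB (dec_adj P cq n)) (catB P) (forget n)
              X (FO (radj (dec_adj P cq n) \<circ>\<^sub>F ladj (dec_adj P cq n)) X))"
proof -
  let ?M = "mon_adj P cq n" and ?D = "dec_adj P cq n"
  interpret tower_comparison P n ?M ?D "FO (Lam P cq n)" by (rule tower_comparison_Lam[OF assms])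
  have RL: "FO (radj ?D \<circ>\<^sub>F ladj ?D) X = D.RO (D.LO X)" for X by (simp add: comp_ftor_def)
  have 1: "X \<in> Im_ftor M.B (Lam P cq n)"
    if "C \<in> Ob M.B" "f \<in> mono_class D.B P.B (forget n) X (FO (Lam P cq n) C)" for X C f
    using Lam_image_of_mono[OF assms that] .
  have 2: "X \<in> Im_ftor M.B (Lam P cq n)"
    if X: "X \<in> Ob D.B" and m: "D.\<eta> X \<in> mono_class D.B P.B (forget n) X (D.RO (D.LO X))" for X
  proof (rule 1)
    have LX: "D.LO X \<in> Ob P.A" using D.LO_ob[OF X] by (simp add: D.catA_eq)
    show "M.RO (D.LO X) \<in> Ob M.B" using M.RO_ob LX by (simp add: M.catA_eq)
    show "D.\<eta> X \<in> mono_class D.B P.B (forget n) X (FO (Lam P cq n) (M.RO (D.LO X)))"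
      using m by (simp add: \<Lambda>_RO[OF LX])
  qed
  have 3: "D.\<eta> X \<in> mono_class D.B P.B (forget n) X (D.RO (D.LO X))"
    if im: "Ext X b \<in> Im_ftor (catB (mon_adj P cq (Suc n))) (Lam P cq (Suc n))" for X b
  proof -
    obtain Y where Y: "Y \<in> Ob (adj_EM ?M)" and "Ext X b = \<Lambda>' Y"
      using im unfolding Im_ftor_def catB_mon_Suc[OF assms] FO_Lam_Suc[OF assms tower_comparison_axioms]
      by blast
    then have "X = FO (Lam P cq n) (lower Y)" by (simp add: \<Lambda>'_def)
    with mono_unt_of_image[OF Y] show ?thesis by simp
  qed
  show ?thesis unfolding RL using 1 2 3 by blast
qed

end
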